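(* Let $a(t)>0$ be a smooth scaling factor, $A(t)=1/a(t)$, $B(t)=A(t)^2$, and let $D$ be the Dirac operator of the Robertson--Walker metric $dt^2+a(t)^2d\sigma^2$ on $\mathbb{R}\times S^3$ ($d\sigma^2$ the round metric on the unit $S^3$), with heat expansion $\mathrm{Tr}(\exp(-\tau^2D^2))\sim\sum_{M\ge0}\tau^{2M-4}\int a_{2M}(t)\,dt$ as $\tau\to0^+$. For every integer $M\ge1$, $$a_{2M}(t)=\frac12\sum{}^{'}\Bigg(\frac{\binom{-n-3/2}{k}\binom{2n}{p}\,k!\,p!}{4^n\,2^{n-M}\,n!}\;I_{\lambda,\mu}\;B(t)^{-n-\frac32-k}\,(A'(t))^{2n-p}\,P_{\lambda,\mu}(t)\Bigg)$$ $$+\frac14\sum{}^{''}\Bigg(\Big(\tbinom{-n-5/2}{k}\tbinom{2n+2}{p}B(t)^{-5/2}(A'(t))^2-\tbinom{-n-1/2}{k}\tbinom{2n}{p}B(t)^{-1/2}\Big)\frac{k!\,p!}{4^n\,2^{\,n-M+1}\,n!}\;I_{\lambda,\mu}\;B(t)^{-n-k}(A'(t))^{2n-p}\,P_{\lambda,\mu}(t)\Bigg),$$ where $$P_{\lambda,\mu}(t)=\prod_{i=1}^\infty\binom{\lambda_i+\mu_i}{\lambda_i}\left(\frac{B^{(i)}(t)}{i!}\right)^{\lambda_i}\left(\frac{A^{(i+1)}(t)}{i!}\right)^{\mu_i},$$ $$I_{\lambda,\mu}=\int_{\Delta^{k+p}}V\big(\underbrace{(1,\dots,1)}_{\lambda_1+\mu_1}\,ш\,\underbrace{(2,\dots,2)}_{\lambda_2+\mu_2}\,ш\cdots\big)\,dv_1\cdots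 dv_{k+p}.$$ The sum $\sum'$ is over all integers $0\le k,p\le 2M$, $0\le n\le M$, $0\le\beta\le 2M-2n$ and, for each such choice, over all sequences $\lambda=(\lambda_1,\lambda_2,\dots)$, $\mu=(\mu_1,\mu_2,\dots)$ of non-negative integers with $|\lambda|'=\beta$, $|\lambda|=k$, $|\mu|'=2M-2n-\beta$, $|\mu|=p$. The sum $\sum''$ is over all integers $0\le k,p\le 2M-2$, $0\le n\le M-1$, $0\le\beta\le2M-2-2n$ and all sequences $\lambda,\mu$ of non-negative integers with $|\lambda|'=\beta$, $|\lambda|=k$, $|\mu|'=2M-2-2n-\beta$, $|\mu|=p$.
   Context: For a sequence $\lambda=(\lambda_1,\lambda_2,\dots)$ of non-negative integers: $|\lambda|=\sum_i\lambda_i$, $|\lambda|'=\sum_i i\lambda_i$. $\Delta^n=\{(v_1,\dots,v_n)\in\mathbb{R}^n:0\le v_1\le\cdots\le v_n\le1\}$. $D[\alpha]$ denotes integration (expectation) with respect to the standard Brownian bridge on $[0,1]$ (centered Gaussian process with covariance $s(1-t)$ for $0\le s\le t\le1$). For $(v_1,\dots,v_n)\in\Delta^n$ and non-negative integers $i_1,\dots,i_n$ with even sum, $$V(i_1,\dots,i_n):=\int\alpha(v_1)^{i_1}\cdots\alpha(v_n)^{i_n}\,D[\alpha],$$ where $(i_1,\dots,i_n)$ is regarded as a word, and $V$ is extended linearly to linear combinations of words. The symbol $ш$ denotes the shuffle product: the shuffle product of words of lengths $p$ and $q$ is the sum of the $\binom{p+q}{p}$ words obtained by interlacing their letters while preserving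 the order of letters within each word. Empty words are omitted; when $k+p=0$ the integral $I_{\lambda,\mu}$ is $1$. $\binom{x}{k}$ for real $x$ is the generalized binomial coefficient. Products are understood after expanding, terms with vanishing binomial coefficient being zero (so no negative powers of $A'(t)$ occur). The coefficients $a_{2M}(t)$ are the heat-trace coefficients prior to time integration. Explicitly, they are given by $a_{2M}(t)=\int\big(\tfrac12C_{2M}^{(-3/2,0)}+\tfrac14(C_{2M-2}^{(-5/2,2)}-C_{2M-2}^{(-1/2,0)})\big)D[\alpha]$ for $M\ge1$, where $C_M^{(r,m)}$ are defined by the formal expansion $e^{V^2/4U}U^rV^m=\tau^{2(r+m)}\sum_{M\ge0}C^{(r,m)}_M\tau^M$, with (here only, $V$ denotes a series) $U=\tau^2\sum_n\frac{u_n}{n!}\tau^n$, $V=\tau^2\sum_n\frac{v_n}{n!}\tau^n$, $u_n=B^{(n)}(t)2^{n/2}x_n(\alpha)$, $v_n=A^{(n+1)}(t)2^{n/2}x_n(\alpha)$, $x_n(\alpha)=\int_0^1\alpha(v)^ndv$. *)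

theory Defs
  imports
    "HOL-Probability.Probability"
    "HOL-Computational_Algebra.Formal_Power_Series"
    "HOL-Library.Multiset"
begin

definition smooth :: "(real \<Rightarrow> real) \<Rightarrow> bool" where
  "smooth f \<longleftrightarrow> (\<forall>n x. ((deriv ^^ n) f) differentiable (at x))"


section \<open>The Brownian bridge\<close>

(* The first alternative is the degenerate Gaussian of variance 0, which has no density. *)
definition centered_gaussian :: "'w measure \<Rightarrow> ('w \<Rightarrow> real) \<Rightarrow> bool" where
  "centered_gaussian \<Omega> Y \<longleftrightarrow> Y \<in> borel_measurable \<Omega> \<and>
     ((AE \<omega> in \<Omega>. Y \<omega> = 0) \<or> (\<exists>\<sigma>>0. distributed \<Omega> lborel Y (normal_density 0 \<sigma>)))"

(* Integration D[\<alpha>] is expectation over any probability space carrying a process with these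
   properties.  As usual for the standard bridge, paths are continuous; values of \<alpha> outside
   [0,1] are irrelevant. *)
locale brownian_bridge = prob_space \<Omega> for \<Omega> :: "'w measure" +
  fixes \<alpha> :: "real \<Rightarrow> 'w \<Rightarrow> real"
  assumes gaussian:
      "\<And>T c. finite T \<Longrightarrow> T \<subseteq> {0..1} \<Longrightarrow> centered_gaussian \<Omega> (\<lambda>\<omega>. \<Sum>s\<in>T. c s * \<alpha> s \<omega>)"
    and covariance:
      "\<And>s t. 0 \<le> s \<Longrightarrow> s \<le> t \<Longrightarrow> t \<le> 1 \<Longrightarrow> expectation (\<lambda>\<omega>. \<alpha> s \<omega> * \<alpha> t \<omega>) = s * (1 - t)"
    and continuous_paths:
      "\<And>\<omega>. \<omega> \<in> space \<Omega> \<Longrightarrow> continuous_on {0..1} (\<lambda>s. \<alpha> s \<omega>)"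


section \<open>The heat coefficients\<close>

(* f^r for real r and a series f with positive constant term f0:
   f^r = f0^r (1 + (f/f0 - 1))^r, expanded by the binomial series. *)
definition fps_rpow :: "real fps \<Rightarrow> real \<Rightarrow> real fps" where
  "fps_rpow f r = fps_const (fps_nth f 0 powr r) *
     (fps_binomial r oo (fps_const (1 / fps_nth f 0) * f - 1))"

definition path_moment :: "(real \<Rightarrow> real) \<Rightarrow> nat \<Rightarrow> real" where
  "path_moment x n = (LINT v:{0..1}|lborel. x v ^ n)"

definition U_series :: "(real \<Rightarrow> real) \<Rightarrow> real \<Rightarrow> (real \<Rightarrow> real) \<Rightarrow> real fps" where
  "U_series B t x = fps_X ^ 2 *
     Abs_fps (\<lambda>n. (deriv ^^ n) B t * 2 powr (real n / 2) * path_moment x n / fact n)"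

definition V_series :: "(real \<Rightarrow> real) \<Rightarrow> real \<Rightarrow> (real \<Rightarrow> real) \<Rightarrow> real fps" where
  "V_series A t x = fps_X ^ 2 *
     Abs_fps (\<lambda>n. (deriv ^^ (n + 1)) A t * 2 powr (real n / 2) * path_moment x n / fact n)"

(* C_M^(r,m) in  e^(V^2/4U) U^r V^m = tau^(2(r+m)) * (SUM M. C_M^(r,m) tau^M),  with tau = fps_X.
   The prefactor tau^(2(r+m)) may have a non-integral exponent; it is removed by dividing U and V
   by tau^2.  The quotient V^2/4U is an exact quotient of power series, starting in degree 2. *)
definition C_coeff ::
    "(real \<Rightarrow> real) \<Rightarrow> (real \<Rightarrow> real) \<Rightarrow> real \<Rightarrow> (real \<Rightarrow> real) \<Rightarrow> real \<Rightarrow> nat \<Rightarrow> nat \<Rightarrow> real" where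
  "C_coeff A B t x r m M =
     (let U = U_series B t x; V = V_series A t x in
      fps_nth ((fps_exp 1 oo (V ^ 2 / (4 * U))) *
               fps_rpow (U / fps_X ^ 2) r * (V / fps_X ^ 2) ^ m) M)"

(* heat_coeff \<Omega> \<alpha> a M t is a_{2M}(t), for M \<ge> 1. *)
definition heat_coeff ::
    "'w measure \<Rightarrow> (real \<Rightarrow> 'w \<Rightarrow> real) \<Rightarrow> (real \<Rightarrow> real) \<Rightarrow> nat \<Rightarrow> real \<Rightarrow> real" where
  "heat_coeff \<Omega> \<alpha> a M t =
     (let A = (\<lambda>s. 1 / a s); B = (\<lambda>s. (A s)\<^sup>2);
          C = (\<lambda>\<omega> r m N. C_coeff A B t (\<lambda>v. \<alpha> v \<omega>) r m N)
      in \<integral>\<omega>. (1/2 * C \<omega> (-3/2) 0 (2*M)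
              + 1/4 * (C \<omega> (-5/2) 2 (2*M - 2) - C \<omega> (-1/2) 0 (2*M - 2))) \<partial>\<Omega>)"


section \<open>Shuffle products and simplex integrals\<close>

(* Sums of words are multisets of words, so words are counted with multiplicity
   (the library's shuffles on lists only yields the underlying set). *)
fun shuffle :: "'a list \<Rightarrow> 'a list \<Rightarrow> 'a list multiset" where
  "shuffle [] ys = {#ys#}"
| "shuffle xs [] = {#xs#}"
| "shuffle (x # xs) (y # ys) =
     image_mset ((#) x) (shuffle xs (y # ys)) + image_mset ((#) y) (shuffle (x # xs) ys)"

lemma size_shuffle: "size (shuffle xs ys) = (length xs + length ys) choose length xs"
  by (induction xs ys rule: shuffle.induct) simp_all

lemma set_mset_shuffle: "set_mset (shuffle xs ys) = shuffles xs ys"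
  by (induction xs ys rule: shuffle.induct) simp_all

definition shuffle_list :: "'a list list \<Rightarrow> 'a list multiset" where
  "shuffle_list ws = foldr (\<lambda>w S. \<Sum>\<^sub># (image_mset (shuffle w) S)) ws {#[]#}"

(* The simplex in R^n; coordinates are numbered 0,...,n-1. *)
definition ordered_simplex :: "nat \<Rightarrow> (nat \<Rightarrow> real) set" where
  "ordered_simplex n = {v \<in> {..<n} \<rightarrow>\<^sub>E {0..1}. mono_on {..<n} v}"

definition V_word ::
    "'w measure \<Rightarrow> (real \<Rightarrow> 'w \<Rightarrow> real) \<Rightarrow> (nat \<Rightarrow> real) \<Rightarrow> nat list \<Rightarrow> real" where
  "V_word \<Omega> \<alpha> v w = (\<integral>\<omega>. (\<Prod>j<length w. \<alpha> (v j) \<omega> ^ (w ! j)) \<partial>\<Omega>)"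

definition V_lin ::
    "'w measure \<Rightarrow> (real \<Rightarrow> 'w \<Rightarrow> real) \<Rightarrow> (nat \<Rightarrow> real) \<Rightarrow> nat list multiset \<Rightarrow> real" where
  "V_lin \<Omega> \<alpha> v S = (\<Sum>w\<in>#S. V_word \<Omega> \<alpha> v w)"

(* Sequences (l_1, l_2, ...) of natural numbers are functions on nat vanishing at 0.
   int_seqs d k is the set of those with SUM i * l_i = d and SUM l_i = k; finiteness of these
   sums means finite support. *)
definition int_seqs :: "nat \<Rightarrow> nat \<Rightarrow> (nat \<Rightarrow> nat) set" where
  "int_seqs d k = {l. l 0 = 0 \<and> finite {i. l i \<noteq> 0} \<and>
     (\<Sum>i | l i \<noteq> 0. i * l i) = d \<and> (\<Sum>i | l i \<noteq> 0. l i) = k}"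

lemma finite_int_seqs: "finite (int_seqs d k)"
proof -
  have "l i \<le> k \<and> (l i \<noteq> 0 \<longrightarrow> i \<le> d)" if l: "l \<in> int_seqs d k" for l i
  proof (cases "l i = 0")
    case False
    have "l i \<le> k" "i * l i \<le> d"
      using l False member_le_sum[of i "{i. l i \<noteq> 0}" l]
        member_le_sum[of i "{i. l i \<noteq> 0}" "\<lambda>i. i * l i"]
      by (auto simp: int_seqs_def)
    moreover have "i \<le> i * l i" using False by simp
    ultimately show ?thesis by linarith
  qed simp
  hence "int_seqs d k \<subseteq> {l. \<forall>i. (i \<in> {..d} \<longrightarrow> l i \<in> {..k}) \<and> (i \<notin> {..d} \<longrightarrow> l i = 0)}"
    by fastforce
  moreover have "finite \<dots>" by (rule finite_set_of_finite_funs) auto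
  ultimately show ?thesis by (rule finite_subset)
qed

(* The blocks are shuffled over i in increasing order, empty ones omitted.  The dimension k + p of
   the simplex is |l| + |m|; in dimension 0 the measure is a point mass, so the integral is 1. *)
definition I_int ::
    "'w measure \<Rightarrow> (real \<Rightarrow> 'w \<Rightarrow> real) \<Rightarrow> (nat \<Rightarrow> nat) \<Rightarrow> (nat \<Rightarrow> nat) \<Rightarrow> real" where
  "I_int \<Omega> \<alpha> l m =
     (let supp = {i. l i + m i \<noteq> 0}; N = (\<Sum>i\<in>supp. l i + m i);
          words = map (\<lambda>i. replicate (l i + m i) i) (sorted_list_of_set supp)
      in LINT v:ordered_simplex N|(\<Pi>\<^sub>M j\<in>{..<N}. lborel). V_lin \<Omega> \<alpha> v (shuffle_list words))"

(* All factors with l i = m i = 0 are equal to 1. *)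
definition P_prod ::
    "(real \<Rightarrow> real) \<Rightarrow> (real \<Rightarrow> real) \<Rightarrow> real \<Rightarrow> (nat \<Rightarrow> nat) \<Rightarrow> (nat \<Rightarrow> nat) \<Rightarrow> real" where
  "P_prod A B t l m = (\<Prod>i | l i + m i \<noteq> 0.
     real ((l i + m i) choose l i) * ((deriv ^^ i) B t / fact i) ^ l i
       * ((deriv ^^ (i + 1)) A t / fact i) ^ m i)"

end

(* After the powers of tau are factored out of U and V, both series have constant terms B(t) and
   A'(t) (because x_0 = 1), so the exponential series, the binomial series for U^(r-n) and the
   binomial theorem for V^(2n+m) reduce a coefficient of e^(V^2/4U) U^r V^m to coefficients of powers
   of series without constant term.  The multinomial theorem turns these into sums over lambda and mu
   of products of derivatives of A and B times PROD x_i^(c_i) / c_i! with c = lambda + mu.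

   Each x_i^(c_i) / c_i! is the iterated integral of alpha^i over a simplex, and products of iterated
   integrals are iterated integrals of shuffles: both sides have the same derivative in the lower
   limit of integration and vanish at 1.  Finally Fubini exchanges the expectation with the integral
   over the simplex; this is legitimate since the moments of alpha(v) are bounded uniformly in v. *)

theory Submission
  imports Defs
begin

section \<open>Expansion of the coefficients\<close>

text \<open>As \<open>g ^ k\<close> starts in degree \<open>k\<close> or later, terms with
  \<open>k > D\<close> contribute nothing and any \<open>K \<ge> D\<close> may end the sum. This
  freedom lets all degrees \<open>2M - 2n\<close> share the range \<open>k \<le> 2M\<close>.\<close>

lemma fps_compose_mult_nth:
  fixes f g h :: "'a::comm_ring_1 fps"
  assumes "fps_nth g 0 = 0" "D \<le> K"
  shows "fps_nth ((f oo g) * h) D = (\<Sum>k\<le>K. fps_nth f k * fps_nth (g ^ k * h) D)"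
proof -
  have *: "fps_nth (f oo g) j = (\<Sum>k\<le>K. fps_nth f k * fps_nth (g ^ k) j)" if "j \<le> D" for j
    unfolding fps_compose_nth
    by (rule sum.mono_neutral_left) (use that assms in \<open>auto simp: startsby_zero_power_prefix\<close>)
  show ?thesis
    unfolding fps_mult_nth
    by (simp add: * sum_distrib_left sum_distrib_right mult.assoc sum.swap[of _ "{0..D}"])
qed

text \<open>A nonzero \<open>l i\<close> forces \<open>i \<le> i * l i \<le> d\<close>. Sums over
  the support thus become sums over a fixed range, which does not change when a single entry is
  updated.\<close>

lemma int_seqs_bounded:
  assumes "d \<le> D"
  shows "int_seqs d k = {l. l 0 = 0 \<and> (\<forall>i>D. l i = 0) \<and> (\<Sum>i\<le>D. i * l i) = d \<and> (\<Sum>i\<le>D. l i) = k}"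
proof -
  have sums: "(\<Sum>i | l i \<noteq> 0. i * l i) = (\<Sum>i\<le>D. i * l i)" "(\<Sum>i | l i \<noteq> 0. l i) = (\<Sum>i\<le>D. l i)"
    if "\<forall>i>D. l i = 0" for l :: "nat \<Rightarrow> nat"
    using that by (auto intro!: sum.mono_neutral_left simp: not_less[symmetric])
  have bound: "\<forall>i>D. l i = 0" if "finite {i. l i \<noteq> 0}" "(\<Sum>i | l i \<noteq> 0. i * l i) = d" for l
  proof (intro allI impI, rule ccontr)
    fix i assume i: "D < i" "l i \<noteq> 0"
    hence "i * l i \<le> d"
      using that member_le_sum[of i "{i. l i \<noteq> 0}" "\<lambda>i. i * l i"] by auto
    moreover have "i \<le> i * l i" using i by simp
    ultimately show False using i assms by linarith
  qed
  have fin: "finite {i. l i \<noteq> 0}" if "\<forall>i>D. l i = 0" for l :: "nat \<Rightarrow> nat"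
    by (rule finite_subset[of _ "{..D}"]) (use that in \<open>auto simp: not_less[symmetric]\<close>)
  show ?thesis
  proof (intro set_eqI iffI)
    fix l assume "l \<in> int_seqs d k"
    moreover from this have "\<forall>i>D. l i = 0" unfolding int_seqs_def by (intro bound) auto
    ultimately show "l \<in> {l. l 0 = 0 \<and> (\<forall>i>D. l i = 0) \<and> (\<Sum>i\<le>D. i * l i) = d \<and> (\<Sum>i\<le>D. l i) = k}"
      using sums[of l] by (simp add: int_seqs_def)
  next
    fix l assume "l \<in> {l. l 0 = 0 \<and> (\<forall>i>D. l i = 0) \<and> (\<Sum>i\<le>D. i * l i) = d \<and> (\<Sum>i\<le>D. l i) = k}"
    thus "l \<in> int_seqs d k" using sums[of l] fin[of l] by (simp add: int_seqs_def)
  qed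
qed

text \<open>Lowering entry \<open>i\<close> by one is a bijection, inverse to raising it; it costs
  \<open>i\<close> in the weighted sum and 1 in the count. This is the recursion behind the
  multinomial theorem.\<close>

lemma sum_int_seqs_Suc:
  fixes W :: "(nat \<Rightarrow> nat) \<Rightarrow> 'b::comm_semiring_1"
  assumes i: "0 < i" "i \<le> d"
  shows "(\<Sum>l\<in>{l\<in>int_seqs d (Suc k). l i \<noteq> 0}. W l) = (\<Sum>l\<in>int_seqs (d - i) k. W (l(i := Suc (l i))))"
proof (rule sum.reindex_bij_witness[of _ "\<lambda>l. l(i := Suc (l i))" "\<lambda>l. l(i := l i - 1)"])
  have S: "(\<Sum>j\<le>d. (l(i := x)) j) = x + (\<Sum>j\<in>{..d}-{i}. l j)"
     "(\<Sum>j\<le>d. j * (l(i := x)) j) = i * x + (\<Sum>j\<in>{..d}-{i}. j * l j)"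
     "(\<Sum>j\<le>d. l j) = l i + (\<Sum>j\<in>{..d}-{i}. l j)"
     "(\<Sum>j\<le>d. j * l j) = i * l i + (\<Sum>j\<in>{..d}-{i}. j * l j)"for l x
    using i by (subst sum.remove[of _ i]; auto intro!: sum.cong)+
  fix l
  { assume "l \<in> {l\<in>int_seqs d (Suc k). l i \<noteq> 0}"
    then obtain y where "l i = Suc y" "l \<in> int_seqs d (Suc k)" by (auto simp: gr0_conv_Suc)
    thus "l(i := l i - 1) \<in> int_seqs (d - i) k"
      using i unfolding int_seqs_bounded[of d d, simplified] int_seqs_bounded[of "d-i" d, simplified]
      by (simp add: S del: fun_upd_apply) (auto simp: S) }
  { assume "l \<in> int_seqs (d - i) k"
    thus "l(i := Suc (l i)) \<in> {l\<in>int_seqs d (Suc k). l i \<noteq> 0}"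
      using i unfolding int_seqs_bounded[of d d, simplified] int_seqs_bounded[of "d-i" d, simplified]
      by (simp add: S del: fun_upd_apply) (auto simp: S) }
qed auto

text \<open>The multinomial theorem, by induction on \<open>k\<close>. The entries of
  \<open>l\<close> add up to \<open>k + 1\<close>, so \<open>(k + 1) * W l\<close> is the sum of the
  \<open>l i * W l\<close>, and each nonzero one is \<open>fps_nth f i\<close> times the weight of
  \<open>l\<close> with entry \<open>i\<close> lowered. This gives the Cauchy product of
  \<open>f\<close> and \<open>f ^ k\<close>. The product range \<open>D\<close> is kept apart from
  \<open>d\<close> so that it stays fixed while \<open>d\<close> drops.\<close>

lemma fps_power_nth_int_seqs:
  fixes f :: "'a::field_char_0 fps"
  assumes f0: "fps_nth f 0 = 0" and "d \<le> D"
  shows "fps_nth (f ^ k) d = fact k * (\<Sum>l\<in>int_seqs d k. \<Prod>i\<le>D. fps_nth f i ^ l i / fact (l i))"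
  using \<open>d \<le> D\<close>
proof (induction k arbitrary: d)
  case 0
  have "int_seqs d 0 = (if d = 0 then {\<lambda>_. 0} else {})"
  proof -
    have "l = (\<lambda>_. 0) \<and> d = 0" if "l \<in> int_seqs d 0" for l
    proof -
      have l: "\<forall>i>d. l i = 0" "(\<Sum>i\<le>d. i * l i) = d" "(\<Sum>i\<le>d. l i) = 0"
        using that unfolding int_seqs_bounded[OF order.refl] by blast+
      from l(1,3) have "l i = 0" for i by (cases "i \<le> d") auto
      hence "l = (\<lambda>_. 0)" by blast
      thus ?thesis using l(2) by simp
    qed
    moreover have "(\<lambda>_. 0) \<in> int_seqs 0 0" by (simp add: int_seqs_def)
    ultimately show ?thesis by (simp only: split: if_split) blast
  qed
  thus ?case by simp
next
  case (Suc k)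
  define W where "W l = (\<Prod>i\<le>D. fps_nth f i ^ l i / fact (l i))" for l
  \<comment> \<open>The factor \<open>l i + 1\<close> cancels against the factorial of the raised
    entry.\<close>
  have W_upd: "of_nat (Suc (l i)) * W (l(i := Suc (l i))) = fps_nth f i * W l" if "i \<le> D" for l i
  proof -
    have "W l' = fps_nth f i ^ l' i / fact (l' i) * (\<Prod>j\<in>{..D}-{i}. fps_nth f j ^ l' j / fact (l' j))" for l'
      unfolding W_def using that by (subst prod.remove[of _ i]) auto
    moreover have "(\<Prod>j\<in>{..D}-{i}. fps_nth f j ^ (l(i := Suc (l i))) j / fact ((l(i := Suc (l i))) j))
      = (\<Prod>j\<in>{..D}-{i}. fps_nth f j ^ l j / fact (l j))"
      by (intro prod.cong) auto
    moreover have "(of_nat (Suc (l i)) :: 'a) \<noteq> 0" by (simp only: of_nat_neq_0 not_False_eq_True)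
    ultimately show ?thesis by (simp del: of_nat_Suc)
  qed
  have "of_nat (Suc k) * (\<Sum>l\<in>int_seqs d (Suc k). W l)
      = (\<Sum>l\<in>int_seqs d (Suc k). \<Sum>i\<in>{1..d}. of_nat (l i) * W l)"
  proof -
    have "(\<Sum>i\<in>{1..d}. l i) = Suc k" if "l \<in> int_seqs d (Suc k)" for l
    proof -
      have "(\<Sum>i\<in>{1..d}. l i) = (\<Sum>i\<le>d. l i)"
        using that by (intro sum.mono_neutral_left) (auto simp: int_seqs_def not_less_eq_eq)
      thus ?thesis using that by (simp add: int_seqs_bounded[OF order.refl])
    qed
    hence "of_nat (Suc k) * W l = of_nat (\<Sum>i\<in>{1..d}. l i) * W l" if "l \<in> int_seqs d (Suc k)" for l
      using that by metis
    thus ?thesis unfolding sum_distrib_left by (intro sum.cong refl) (simp only: of_nat_sum sum_distrib_right)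
  qed
  also have "\<dots> = (\<Sum>i\<in>{1..d}. \<Sum>l\<in>{l\<in>int_seqs d (Suc k). l i \<noteq> 0}. of_nat (l i) * W l)"
    by (subst sum.swap, intro sum.cong refl sum.mono_neutral_right) (auto simp: finite_int_seqs)
  also have "\<dots> = (\<Sum>i\<in>{1..d}. \<Sum>l\<in>int_seqs (d - i) k. fps_nth f i * W l)"
  proof (rule sum.cong[OF refl])
    fix i assume i: "i \<in> {1..d}"
    have "(\<Sum>l\<in>{l\<in>int_seqs d (Suc k). l i \<noteq> 0}. of_nat (l i) * W l)
        = (\<Sum>l\<in>int_seqs (d - i) k. of_nat ((l(i := Suc (l i))) i) * W (l(i := Suc (l i))))"
      by (rule sum_int_seqs_Suc) (use i in auto)
    also have "\<dots> = (\<Sum>l\<in>int_seqs (d - i) k. fps_nth f i * W l)"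
      unfolding fun_upd_same by (intro sum.cong refl W_upd) (use i Suc.prems in auto)
    finally show "(\<Sum>l\<in>{l\<in>int_seqs d (Suc k). l i \<noteq> 0}. of_nat (l i) * W l)
        = (\<Sum>l\<in>int_seqs (d - i) k. fps_nth f i * W l)" .
  qed
  finally have "fact (Suc k) * (\<Sum>l\<in>int_seqs d (Suc k). W l) = (\<Sum>i\<in>{1..d}. fps_nth f i * (fact k * (\<Sum>l\<in>int_seqs (d - i) k. W l)))"
    by (simp add: sum_distrib_left mult_ac)
  also have "\<dots> = (\<Sum>i\<in>{1..d}. fps_nth f i * fps_nth (f ^ k) (d - i))"
    using Suc.IH Suc.prems by (intro sum.cong refl) (simp add: W_def)
  \<comment> \<open>The term \<open>i = 0\<close> may be added because \<open>f\<close> has no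
    constant term.\<close>
  also have "\<dots> = (\<Sum>i=0..d. fps_nth f i * fps_nth (f ^ k) (d - i))"
    using f0 by (intro sum.mono_neutral_left) (auto simp: not_less_eq_eq)
  finally show ?case by (simp add: fps_mult_nth W_def)
qed

section \<open>Real powers of series and binomial expansions about the constant term\<close>

text \<open>Multiplicativity of the binomial series in its exponent survives the composition, since
  the inner series has no constant term.\<close>

lemma fps_rpow_mult:
  assumes "fps_nth f 0 > 0"
  shows "fps_rpow f r * fps_rpow f s = fps_rpow f (r + s)"
proof -
  have "fps_nth (fps_const (1 / fps_nth f 0) * f - 1) 0 = 0" using assms by simp
  thus ?thesis
    by (simp add: fps_rpow_def fps_binomial_add_mult fps_compose_mult_distrib powr_add
        fps_const_mult[symmetric] mult_ac del: fps_const_mult)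
qed

lemma fps_rpow_1:
  assumes "fps_nth f 0 > 0"
  shows "fps_rpow f 1 = f"
proof -
  have "fps_const (fps_nth f 0) * (fps_const (1 / fps_nth f 0) * f) = f"
    using assms by (simp flip: mult.assoc)
  thus ?thesis using assms
    by (simp add: fps_rpow_def fps_binomial_1 fps_compose_add_distrib)
qed

text \<open>Lets the powers of \<open>inverse u\<close> coming from the exponential be absorbed into
  the real exponent.\<close>

lemma fps_rpow_diff_mult_power:
  assumes "fps_nth f 0 > 0"
  shows "fps_rpow f (r - real n) * f ^ n = fps_rpow f r"
proof (induction n)
  case (Suc n)
  have "fps_rpow f (r - real (Suc n)) * f ^ Suc n = (fps_rpow f (r - real (Suc n)) * fps_rpow f 1) * f ^ n"
    by (simp add: fps_rpow_1[OF assms] mult_ac)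
  also have "\<dots> = fps_rpow f (r - real n) * f ^ n"
    by (simp add: fps_rpow_mult[OF assms])
  finally show ?case using Suc by simp
qed simp

text \<open>Binomial series in \<open>g\<close> divided by the constant term of \<open>f\<close>;
  the \<open>k\<close>-th power of that divisor merges with the real power in front.\<close>

lemma fps_rpow_mult_nth:
  assumes pos: "fps_nth f 0 > 0" and "D \<le> K"
  shows "fps_nth (fps_rpow f r * h) D =
    (\<Sum>k\<le>K. (r gchoose k) * fps_nth f 0 powr (r - real k) * fps_nth ((f - fps_const (fps_nth f 0)) ^ k * h) D)"
proof -
  define g where "g = f - fps_const (fps_nth f 0)"
  have g: "fps_const (1 / fps_nth f 0) * f - 1 = fps_const (1 / fps_nth f 0) * g"
    using pos by (simp add: g_def algebra_simps)
  have nth: "fps_nth ((fps_const (1 / fps_nth f 0) * g) ^ k * h) D = fps_nth (g ^ k * h) D / fps_nth f 0 ^ k" for k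
    by (simp add: power_mult_distrib fps_const_power mult.assoc power_one_over)
  have "fps_nth (fps_rpow f r * h) D =
      fps_nth f 0 powr r * fps_nth ((fps_binomial r oo fps_const (1 / fps_nth f 0) * g) * h) D"
    by (simp add: fps_rpow_def g mult.assoc)
  also have "\<dots> = fps_nth f 0 powr r * (\<Sum>k\<le>K. (r gchoose k) * (fps_nth (g ^ k * h) D / fps_nth f 0 ^ k))"
    by (subst fps_compose_mult_nth[OF _ \<open>D \<le> K\<close>]) (simp_all add: g_def nth[unfolded g_def])
  finally show ?thesis
    using pos by (simp add: g_def sum_distrib_left powr_diff powr_realpow field_simps)
qed

text \<open>The binomial theorem gives a sum over \<open>p \<le> q\<close>; both this sum and the
  one over \<open>p \<le> P\<close> agree with the sum up to \<open>max q P\<close>. Terms beyond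
  \<open>q\<close> vanish through the binomial coefficient, which makes the truncated exponent
  \<open>q - p\<close> harmless, and terms beyond \<open>D\<close> vanish because
  \<open>g ^ p\<close> has no terms of degree below \<open>p\<close>.\<close>

lemma fps_power_mult_nth:
  fixes f h :: "'a::comm_ring_1 fps"
  assumes "D \<le> P"
  shows "fps_nth (f ^ q * h) D =
    (\<Sum>p\<le>P. of_nat (q choose p) * fps_nth f 0 ^ (q - p) * fps_nth ((f - fps_const (fps_nth f 0)) ^ p * h) D)"
proof -
  define g where "g = f - fps_const (fps_nth f 0)"
  define F where "F p = of_nat (q choose p) * fps_nth f 0 ^ (q - p) * fps_nth (g ^ p * h) D" for p
  have zero: "fps_nth (g ^ p * h) D = 0" if "p > D" for p
  proof -
    have "fps_nth g 0 = 0" by (simp add: g_def)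
    hence "fps_nth (g ^ p) i = 0" if "i \<le> D" for i
      using startsby_zero_power_prefix[of g] that \<open>p > D\<close> by auto
    thus ?thesis unfolding fps_mult_nth by simp
  qed
  have "f ^ q = (g + fps_const (fps_nth f 0)) ^ q" by (simp add: g_def)
  also have "\<dots> = (\<Sum>p\<le>q. of_nat (q choose p) * g ^ p * fps_const (fps_nth f 0) ^ (q - p))"
    by (rule binomial_ring)
  finally have "f ^ q * h = (\<Sum>p\<le>q. fps_const (of_nat (q choose p) * fps_nth f 0 ^ (q - p)) * (g ^ p * h))"
    by (simp add: sum_distrib_right sum_distrib_left fps_const_power fps_of_nat[symmetric] mult_ac
        fps_const_mult[symmetric] del: fps_const_mult)
  hence "fps_nth (f ^ q * h) D = (\<Sum>p\<le>q. F p)"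
    by (simp add: fps_sum_nth F_def)
  also have "\<dots> = (\<Sum>p\<le>max q P. F p)"
    by (rule sum.mono_neutral_left) (auto simp: F_def binomial_eq_0)
  also have "\<dots> = (\<Sum>p\<le>P. F p)"
    by (rule sum.mono_neutral_right) (use zero assms in \<open>auto simp: F_def\<close>)
  finally show ?thesis by (simp add: F_def g_def)
qed

section \<open>The coefficients \<open>C_coeff\<close> in terms of path moments\<close>

text \<open>The exponent is \<open>fps_X ^ 2 * H\<close>, so the \<open>n\<close>-th term of the
  exponential lowers the degree to be extracted by \<open>2 * n\<close>, and only
  \<open>n \<le> M\<close> survive.\<close>

lemma C_coeff_expand_n:
  fixes A B :: "real \<Rightarrow> real" and t :: real and x :: "real \<Rightarrow> real"
  defines "u \<equiv> Abs_fps (\<lambda>n. (deriv ^^ n) B t * 2 powr (real n / 2) * path_moment x n / fact n)"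
    and "v \<equiv> Abs_fps (\<lambda>n. (deriv ^^ (n + 1)) A t * 2 powr (real n / 2) * path_moment x n / fact n)"
  assumes pos: "fps_nth u 0 > 0"
  shows "C_coeff A B t x r m (2 * M) =
    (\<Sum>n\<le>M. 1 / (4 ^ n * fact n) * fps_nth (fps_rpow u (r - real n) * v ^ (2 * n + m)) (2 * M - 2 * n))"
proof -
  define H where "H = fps_const (1 / 4) * (v ^ 2 * inverse u)"
  have U: "U_series B t x = fps_X ^ 2 * u" and V: "V_series A t x = fps_X ^ 2 * v"
    by (simp_all add: U_series_def V_series_def u_def v_def)
  have u0: "u \<noteq> 0" "u * inverse u = 1" using pos by (auto simp: inverse_mult_eq_1')
  have X: "fps_X ^ 2 \<noteq> (0 :: real fps)" by simp
  have c: "fps_const (1 / 4) * 4 = (1 :: real fps)"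
    by (simp add: numeral_fps_const)
  \<comment> \<open>The numerator is exhibited as a multiple of the denominator, so that the
    division of series is exact.\<close>
  have "(fps_X ^ 2 * v) ^ 2 = (fps_X ^ 2 * v) ^ 2 * (fps_const (1 / 4) * 4) * (u * inverse u)"
    by (simp only: c u0 mult_1_right)
  also have "\<dots> = (fps_X ^ 2 * H) * (4 * (fps_X ^ 2 * u))"
    by (simp add: H_def power_mult_distrib power2_eq_square mult_ac)
  finally have quot: "(fps_X ^ 2 * v) ^ 2 / (4 * (fps_X ^ 2 * u)) = fps_X ^ 2 * H"
    using u0 by simp
  \<comment> \<open>Here \<open>fps_rpow u r\<close> is split as
    \<open>fps_rpow u (r - real n) * u ^ n\<close>, whose second factor cancels
    \<open>inverse u ^ n\<close>.\<close>
  have "H ^ n * (fps_rpow u r * v ^ m)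
      = fps_const (1 / 4 ^ n) * (fps_rpow u (r - real n) * (u ^ n * inverse u ^ n) * (v ^ (2 * n) * v ^ m))" for n
    unfolding H_def fps_rpow_diff_mult_power[OF pos, of r n, symmetric]
    by (simp add: power_mult_distrib fps_const_power power_one_over mult_ac flip: power_mult)
  moreover have "u ^ n * inverse u ^ n = 1" for n
    by (simp only: power_mult_distrib[symmetric] u0 power_one)
  ultimately have H: "H ^ n * (fps_rpow u r * v ^ m)
      = fps_const (1 / 4 ^ n) * (fps_rpow u (r - real n) * v ^ (2 * n + m))" for n
    by (simp add: power_add)
  have "C_coeff A B t x r m (2 * M)
      = fps_nth ((fps_exp 1 oo (fps_X ^ 2 * H)) * (fps_rpow u r * v ^ m)) (2 * M)"
    unfolding C_coeff_def Let_def U V quot by (simp only: nonzero_mult_div_cancel_left[OF X] mult.assoc)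
  also have "\<dots> = (\<Sum>n\<le>2*M. 1 / fact n * fps_nth (fps_X ^ (2 * n) * (H ^ n * (fps_rpow u r * v ^ m))) (2 * M))"
    by (subst fps_compose_mult_nth[of _ _ "2 * M"])
      (simp_all add: power_mult_distrib power_mult mult.assoc)
  also have "\<dots> = (\<Sum>n\<le>M. 1 / fact n * fps_nth (fps_X ^ (2 * n) * (H ^ n * (fps_rpow u r * v ^ m))) (2 * M))"
    by (rule sum.mono_neutral_right) (auto simp: fps_X_power_mult_nth)
  also have "\<dots> = (\<Sum>n\<le>M. 1 / (4 ^ n * fact n) * fps_nth (fps_rpow u (r - real n) * v ^ (2 * n + m)) (2 * M - 2 * n))"
    unfolding H by (intro sum.cong refl) (simp add: fps_X_power_mult_nth)
  finally show ?thesis .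
qed

definition scaled_moment :: "(real \<Rightarrow> real) \<Rightarrow> (nat \<Rightarrow> nat) \<Rightarrow> real" where
  "scaled_moment x c = (\<Prod>i | c i \<noteq> 0. path_moment x i ^ c i / fact (c i))"

text \<open>Entry by entry, the two factorials in the denominators regroup into a binomial
  coefficient over \<open>fact (l i + m i)\<close>. Index 0 is exempt in \<open>u\<close> and
  \<open>v\<close> because \<open>l 0 = m 0 = 0\<close>; in the application the constant terms have
  been removed.\<close>

lemma prod_int_seqs_P_prod:
  assumes l: "l \<in> int_seqs \<beta> k" and m: "m \<in> int_seqs \<gamma> p" and \<beta>\<gamma>: "\<beta> + \<gamma> = 2 * d" and D: "2 * d \<le> D"
    and u: "\<And>i. i \<noteq> 0 \<Longrightarrow> u i = (deriv ^^ i) B t * 2 powr (real i / 2) * path_moment x i / fact i"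
    and v: "\<And>i. i \<noteq> 0 \<Longrightarrow> v i = (deriv ^^ (i + 1)) A t * 2 powr (real i / 2) * path_moment x i / fact i"
  shows "(\<Prod>i\<le>D. u i ^ l i / fact (l i)) * (\<Prod>i\<le>D. v i ^ m i / fact (m i))
    = 2 ^ d * P_prod A B t l m * scaled_moment x (\<lambda>i. l i + m i)"
proof -
  have l': "l 0 = 0" "\<forall>i>D. l i = 0" "(\<Sum>i\<le>D. i * l i) = \<beta>"
    using l \<beta>\<gamma> D by (auto simp: int_seqs_bounded[of \<beta> D])
  have m': "m 0 = 0" "\<forall>i>D. m i = 0" "(\<Sum>i\<le>D. i * m i) = \<gamma>"
    using m \<beta>\<gamma> D by (auto simp: int_seqs_bounded[of \<gamma> D])
  have supp: "{i. l i + m i \<noteq> 0} \<subseteq> {..D}" using l'(2) m'(2) by (auto simp: not_less[symmetric])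
  have P: "P_prod A B t l m = (\<Prod>i\<le>D. real ((l i + m i) choose l i) * ((deriv ^^ i) B t / fact i) ^ l i
       * ((deriv ^^ (i + 1)) A t / fact i) ^ m i)"
    unfolding P_prod_def using supp by (intro prod.mono_neutral_left) auto
  have S: "scaled_moment x (\<lambda>i. l i + m i)
      = (\<Prod>i\<le>D. path_moment x i ^ (l i + m i) / fact (l i + m i))"
    unfolding scaled_moment_def using supp by (intro prod.mono_neutral_left) auto
  \<comment> \<open>The half-integral exponents add up to
    \<open>(\<beta> + \<gamma>) / 2 = d\<close>, so an integral power of 2 remains.\<close>
  have pow2: "(\<Prod>i\<le>D. (2 powr (real i / 2)) ^ (l i + m i)) = 2 ^ d"
  proof -
    have "(\<Prod>i\<le>D. (2 powr (real i / 2)) ^ (l i + m i)) = (\<Prod>i\<le>D. 2 powr (real (i * (l i + m i)) / 2))"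
      by (intro prod.cong refl) (simp add: powr_power mult_ac)
    also have "\<dots> = 2 powr (real (\<Sum>i\<le>D. i * (l i + m i)) / 2)"
      by (simp add: powr_sum sum_divide_distrib)
    also have "(\<Sum>i\<le>D. i * (l i + m i)) = 2 * d"
      using l'(3) m'(3) \<beta>\<gamma> by (simp add: distrib_left sum.distrib)
    finally show ?thesis by (simp add: powr_realpow)
  qed
  have "(\<Prod>i\<le>D. u i ^ l i / fact (l i)) * (\<Prod>i\<le>D. v i ^ m i / fact (m i))
      = (\<Prod>i\<le>D. (2 powr (real i / 2)) ^ (l i + m i)
        * (real ((l i + m i) choose l i) * ((deriv ^^ i) B t / fact i) ^ l i * ((deriv ^^ (i + 1)) A t / fact i) ^ m i)
        * (path_moment x i ^ (l i + m i) / fact (l i + m i)))"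
    unfolding prod.distrib[symmetric]
  proof (intro prod.cong refl)
    fix i
    show "u i ^ l i / fact (l i) * (v i ^ m i / fact (m i)) = (2 powr (real i / 2)) ^ (l i + m i)
        * (real ((l i + m i) choose l i) * ((deriv ^^ i) B t / fact i) ^ l i * ((deriv ^^ (i + 1)) A t / fact i) ^ m i)
        * (path_moment x i ^ (l i + m i) / fact (l i + m i))"
    proof (cases "i = 0")
      case True
      thus ?thesis using l'(1) m'(1) by simp
    next
      case False
      have "real ((l i + m i) choose l i) = fact (l i + m i) / (fact (l i) * fact (m i))"
        by (subst binomial_fact) simp_all
      thus ?thesis unfolding u[OF False] v[OF False]
        by (simp add: power_mult_distrib power_divide power_add mult_ac)
    qed
  qed
  thus ?thesis unfolding P S pow2[symmetric] prod.distrib[symmetric] .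
qed

lemma C_coeff_expand:
  assumes B_pos: "B t > 0" and x0: "path_moment x 0 = 1"
  shows "C_coeff A B t x r m (2 * M) =
    (\<Sum>k\<le>2*M. \<Sum>p\<le>2*M. \<Sum>n\<le>M. \<Sum>\<beta>\<le>2*M - 2*n. \<Sum>l\<in>int_seqs \<beta> k. \<Sum>l'\<in>int_seqs (2*M - 2*n - \<beta>) p.
      ((r - real n) gchoose k) * real ((2*n + m) choose p) * fact k * fact p * 2 ^ (M - n) / (4 ^ n * fact n)
      * B t powr (r - real n - real k) * (deriv A t) ^ (2*n + m - p) * P_prod A B t l l'
      * scaled_moment x (\<lambda>i. l i + l' i))"
    (is "_ = ?rhs")
proof -
  define u where "u = Abs_fps (\<lambda>n. (deriv ^^ n) B t * 2 powr (real n / 2) * path_moment x n / fact n)"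
  define v where "v = Abs_fps (\<lambda>n. (deriv ^^ (n + 1)) A t * 2 powr (real n / 2) * path_moment x n / fact n)"
  have u0: "fps_nth u 0 = B t" and v0: "fps_nth v 0 = deriv A t"
    using x0 by (simp_all add: u_def v_def)
  define u' where "u' = u - fps_const (B t)"
  define v' where "v' = v - fps_const (deriv A t)"
  have u'0: "fps_nth u' 0 = 0" and v'0: "fps_nth v' 0 = 0" by (simp_all add: u'_def v'_def u0 v0)
  define c where "c k p n = ((r - real n) gchoose k) * real ((2*n + m) choose p) / (4 ^ n * fact n)
      * B t powr (r - real n - real k) * (deriv A t) ^ (2*n + m - p)" for k p n
  \<comment> \<open>The Cauchy product gives degree \<open>\<beta>\<close> to the power of
    \<open>u'\<close> and the rest to that of \<open>v'\<close>; the multinomial theorem applies to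
    each.\<close>
  have coeff: "fps_nth (u' ^ k * v' ^ p) (2 * M - 2 * n) =
     (\<Sum>\<beta>\<le>2*M - 2*n. \<Sum>l\<in>int_seqs \<beta> k. \<Sum>l'\<in>int_seqs (2*M - 2*n - \<beta>) p.
       fact k * fact p * (2 ^ (M - n) * P_prod A B t l l' * scaled_moment x (\<lambda>i. l i + l' i)))"
    if "n \<le> M" for k p n
  proof -
    have "fps_nth (u' ^ k * v' ^ p) (2 * M - 2 * n)
       = (\<Sum>\<beta>\<le>2*M - 2*n. (fact k * (\<Sum>l\<in>int_seqs \<beta> k. \<Prod>i\<le>2*M. fps_nth u' i ^ l i / fact (l i)))
          * (fact p * (\<Sum>l\<in>int_seqs (2*M - 2*n - \<beta>) p. \<Prod>i\<le>2*M. fps_nth v' i ^ l i / fact (l i))))"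
      unfolding fps_mult_nth atLeast0AtMost
      by (intro sum.cong refl arg_cong2[where f="(*)"] fps_power_nth_int_seqs u'0 v'0) auto
    also have "\<dots> = (\<Sum>\<beta>\<le>2*M - 2*n. \<Sum>l\<in>int_seqs \<beta> k. \<Sum>l'\<in>int_seqs (2*M - 2*n - \<beta>) p. fact k * fact p *
          ((\<Prod>i\<le>2*M. fps_nth u' i ^ l i / fact (l i)) * (\<Prod>i\<le>2*M. fps_nth v' i ^ l' i / fact (l' i))))"
      by (intro sum.cong refl) (simp add: sum_distrib_left sum_distrib_right mult_ac sum.swap[of _ "int_seqs _ p"])
    also have "\<dots> = (\<Sum>\<beta>\<le>2*M - 2*n. \<Sum>l\<in>int_seqs \<beta> k. \<Sum>l'\<in>int_seqs (2*M - 2*n - \<beta>) p.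
       fact k * fact p * (2 ^ (M - n) * P_prod A B t l l' * scaled_moment x (\<lambda>i. l i + l' i)))"
      by (intro sum.cong refl arg_cong2[where f="(*)"] prod_int_seqs_P_prod)
        (assumption | simp add: u'_def v'_def u_def v_def)+
    finally show ?thesis .
  qed
  have "C_coeff A B t x r m (2 * M) =
      (\<Sum>n\<le>M. 1 / (4 ^ n * fact n) * fps_nth (fps_rpow u (r - real n) * v ^ (2 * n + m)) (2 * M - 2 * n))"
    unfolding u_def v_def by (rule C_coeff_expand_n) (use B_pos u0 in \<open>simp add: u_def\<close>)
  also have "\<dots> = (\<Sum>n\<le>M. \<Sum>k\<le>2*M. \<Sum>p\<le>2*M. c k p n * fps_nth (u' ^ k * v' ^ p) (2 * M - 2 * n))"
  proof (intro sum.cong refl)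
    fix n assume "n \<in> {..M}"
    have "fps_nth (fps_rpow u (r - real n) * v ^ (2 * n + m)) (2 * M - 2 * n)
       = (\<Sum>k\<le>2*M. ((r - real n) gchoose k) * B t powr (r - real n - real k) *
            fps_nth (v ^ (2 * n + m) * u' ^ k) (2 * M - 2 * n))"
      by (subst fps_rpow_mult_nth[of _ _ "2 * M"]) (simp_all add: u0 B_pos u'_def mult_ac)
    also have "\<dots> = (\<Sum>k\<le>2*M. ((r - real n) gchoose k) * B t powr (r - real n - real k) *
       (\<Sum>p\<le>2*M. real ((2*n + m) choose p) * (deriv A t) ^ (2*n + m - p) * fps_nth (v' ^ p * u' ^ k) (2 * M - 2 * n)))"
      by (subst fps_power_mult_nth[of _ "2 * M"]) (simp_all add: v0 v'_def)
    finally show "1 / (4 ^ n * fact n) * fps_nth (fps_rpow u (r - real n) * v ^ (2 * n + m)) (2 * M - 2 * n)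
       = (\<Sum>k\<le>2*M. \<Sum>p\<le>2*M. c k p n * fps_nth (u' ^ k * v' ^ p) (2 * M - 2 * n))"
      by (simp add: sum_distrib_left c_def mult_ac)
  qed
  also have "\<dots> = (\<Sum>k\<le>2*M. \<Sum>p\<le>2*M. \<Sum>n\<le>M. c k p n * fps_nth (u' ^ k * v' ^ p) (2 * M - 2 * n))"
    by (rule trans[OF sum.swap], rule sum.cong[OF refl], rule sum.swap)
  also have "\<dots> = ?rhs"
    by (intro sum.cong refl, subst coeff) (simp_all add: sum_distrib_left sum_divide_distrib c_def mult_ac)
  finally show ?thesis .
qed

section \<open>Iterated integrals and shuffles\<close>

text \<open>With the lower limit as the variable, differentiation removes the first letter, in step
  with the recursion of \<open>shuffle\<close> on first letters.\<close>

fun iterated_integral :: "('a \<Rightarrow> real \<Rightarrow> real) \<Rightarrow> 'a list \<Rightarrow> real \<Rightarrow> real" where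
  "iterated_integral g [] s = 1"
| "iterated_integral g (x # xs) s = integral {s..1} (\<lambda>v. g x v * iterated_integral g xs v)"

text \<open>The device for proving identities between iterated integrals: differentiate in the lower
  limit and compare at 1.\<close>

lemma integral_Icc_eq_antiderivative:
  fixes F f :: "real \<Rightarrow> real"
  assumes "\<And>v. v \<in> {0..1} \<Longrightarrow> (F has_real_derivative - f v) (at v within {0..1})"
    and "F 1 = 0" and s: "s \<in> {0..1}"
  shows "integral {s..1} f = F s"
proof -
  have "((\<lambda>v. - f v) has_integral F 1 - F s) {s..1}"
  proof (rule fundamental_theorem_of_calculus)
    show "s \<le> 1" using s by simp
    fix v assume "v \<in> {s..1}"
    hence "(F has_real_derivative - f v) (at v within {s..1})"
      using assms(1)[of v] s by (intro DERIV_subset[of F _ v "{0..1}" "{s..1}"]) auto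
    thus "(F has_vector_derivative - f v) (at v within {s..1})"
      by (simp add: has_real_derivative_iff_has_vector_derivative)
  qed
  from has_integral_neg[OF this] show ?thesis
    using assms(2) by (simp add: integral_unique)
qed

lemma has_real_derivative_integral_Icc:
  fixes f :: "real \<Rightarrow> real"
  assumes "continuous_on {0..1} f" "s \<in> {0..1}"
  shows "((\<lambda>s. integral {s..1} f) has_real_derivative - f s) (at s within {0..1})"
  by (rule integral_has_real_derivative'[OF assms])

lemma continuous_on_integral_Icc:
  fixes f :: "real \<Rightarrow> real"
  assumes "continuous_on {0..1} f"
  shows "continuous_on {0..1} (\<lambda>s. integral {s..1} f)"
  by (rule DERIV_continuous_on[OF has_real_derivative_integral_Icc[OF assms]])

context
  fixes g :: "'a \<Rightarrow> real \<Rightarrow> real"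
  assumes cont: "\<And>x. continuous_on {0..1} (g x)"
begin

lemma continuous_on_iterated_integral: "continuous_on {0..1} (iterated_integral g w)"
proof (induction w)
  case Nil
  show ?case by simp
next
  case (Cons x xs)
  show ?case unfolding iterated_integral.simps
    by (intro continuous_on_integral_Icc continuous_intros cont Cons.IH)
qed

text \<open>Linearity of the outermost integration; it collects the words of a shuffle that share
  their first letter into one integral.\<close>

lemma iterated_integral_sum_mset:
  assumes "s \<in> {0..1}"
  shows "(\<Sum>z\<in>#S. iterated_integral g (x # z) s)
    = integral {s..1} (\<lambda>v. g x v * (\<Sum>z\<in>#S. iterated_integral g z v))"
proof (induction S)
  case (add w S)
  have c: "continuous_on {s..1} (\<lambda>v. \<Sum>z\<in>#S. iterated_integral g z v)"
    by (induction S) (use assms in \<open>auto intro!: continuous_intros continuous_on_subset[OF continuous_on_iterated_integral]\<close>)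
  show ?case
    unfolding image_mset_add_mset sum_mset.add_mset add.IH distrib_left
    unfolding iterated_integral.simps
    by (rule integral_add[symmetric]; rule integrable_continuous_real)
      (use assms in \<open>auto intro!: continuous_intros c continuous_on_subset[OF continuous_on_iterated_integral]
         continuous_on_subset[OF cont]\<close>)
qed simp

text \<open>This is the product rule. Its two terms remove the letter \<open>x\<close> or the letter
  \<open>y\<close>, and by induction they are the integrands for the shuffled words beginning with
  \<open>x\<close> and with \<open>y\<close>.\<close>

lemma iterated_integral_shuffle:
  "s \<in> {0..1} \<Longrightarrow> (\<Sum>z\<in>#shuffle u w. iterated_integral g z s) = iterated_integral g u s * iterated_integral g w s"
proof (induction u w arbitrary: s rule: shuffle.induct)
  case (3 x xs y ys)
  let ?J = "iterated_integral g"
  have "(\<Sum>z\<in>#shuffle (x # xs) (y # ys). ?J z s)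
      = (\<Sum>z\<in>#shuffle xs (y # ys). ?J (x # z) s) + (\<Sum>z\<in>#shuffle (x # xs) ys. ?J (y # z) s)"
    by (simp add: image_mset.compositionality o_def)
  also have "\<dots> = integral {s..1} (\<lambda>v. g x v * (?J xs v * ?J (y # ys) v)) + integral {s..1} (\<lambda>v. g y v * (?J (x # xs) v * ?J ys v))"
    unfolding iterated_integral_sum_mset[OF 3(3)]
    by (intro arg_cong2[where f="(+)"] integral_cong arg_cong2[where f="(*)"] refl 3) (use 3(3) in auto)
  also have "\<dots> = integral {s..1} (\<lambda>v. g x v * (?J xs v * ?J (y # ys) v) + g y v * (?J (x # xs) v * ?J ys v))"
    by (rule integral_add[symmetric]; rule integrable_continuous_real)
      (use 3(3) in \<open>auto intro!: continuous_intros continuous_on_subset[OF continuous_on_iterated_integral]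
         continuous_on_subset[OF cont] simp del: iterated_integral.simps\<close>)
  also have "\<dots> = ?J (x # xs) s * ?J (y # ys) s"
  proof (rule integral_Icc_eq_antiderivative[OF _ _ 3(3)])
    fix v :: real assume v: "v \<in> {0..1}"
    have d: "(?J (x # xs) has_real_derivative - (g x v * ?J xs v)) (at v within {0..1})" for x xs
      unfolding iterated_integral.simps
      by (rule has_real_derivative_integral_Icc[OF _ v]) (intro continuous_intros cont continuous_on_iterated_integral)
    show "((\<lambda>v. ?J (x # xs) v * ?J (y # ys) v) has_real_derivative
      - (g x v * (?J xs v * ?J (y # ys) v) + g y v * (?J (x # xs) v * ?J ys v))) (at v within {0..1})"
      by (rule DERIV_cong[OF DERIV_mult[OF d d]]) (simp add: algebra_simps del: iterated_integral.simps)
  qed simp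
  finally show ?case .
qed simp_all

text \<open>If \<open>F\<close> is the integral of \<open>g x\<close> from the lower limit to 1,
  then \<open>F ^ Suc c / fact (Suc c)\<close> has derivative
  \<open>- (g x * F ^ c / fact c)\<close>.\<close>

lemma iterated_integral_replicate:
  "s \<in> {0..1} \<Longrightarrow> iterated_integral g (replicate c x) s = integral {s..1} (g x) ^ c / fact c"
proof (induction c arbitrary: s)
  case (Suc c)
  define F where "F s = integral {s..1} (g x)" for s
  have "iterated_integral g (replicate (Suc c) x) s = integral {s..1} (\<lambda>v. g x v * (F v ^ c / fact c))"
    unfolding replicate_Suc iterated_integral.simps F_def
    by (intro integral_cong arg_cong2[where f="(*)"] refl Suc.IH) (use Suc.prems in auto)
  also have "\<dots> = F s ^ Suc c / fact (Suc c)"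
  proof (rule integral_Icc_eq_antiderivative[OF _ _ Suc.prems])
    fix v :: real assume v: "v \<in> {0..1}"
    have "(F has_real_derivative - g x v) (at v within {0..1})"
      unfolding F_def by (rule has_real_derivative_integral_Icc[OF cont v])
    thus "((\<lambda>v. F v ^ Suc c / fact (Suc c)) has_real_derivative - (g x v * (F v ^ c / fact c))) (at v within {0..1})"
      by (rule DERIV_cong[OF DERIV_cdivide[OF DERIV_power]]) (simp add: mult_ac del: of_nat_Suc)
  qed (simp add: F_def)
  finally show ?case by (simp add: F_def)
qed simp

lemma iterated_integral_shuffle_list:
  assumes "s \<in> {0..1}"
  shows "(\<Sum>z\<in>#shuffle_list ws. iterated_integral g z s) = (\<Prod>w\<leftarrow>ws. iterated_integral g w s)"
proof (induction ws)
  case Nil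
  show ?case by (simp add: shuffle_list_def)
next
  case (Cons w ws)
  have "(\<Sum>z\<in>#\<Sum>\<^sub># (image_mset (shuffle w) S). iterated_integral g z s)
      = iterated_integral g w s * (\<Sum>z\<in>#S. iterated_integral g z s)" for S
    by (induction S) (simp_all add: iterated_integral_shuffle[OF assms] distrib_left)
  from this[of "shuffle_list ws"] show ?case using Cons by (simp add: shuffle_list_def)
qed

end

section \<open>Shuffles of constant blocks\<close>

lemma length_shuffle_list: "z \<in># shuffle_list ws \<Longrightarrow> length z = (\<Sum>w\<leftarrow>ws. length w)"
proof (induction ws arbitrary: z)
  case (Cons w ws)
  then obtain y where y: "y \<in># shuffle_list ws" "z \<in># shuffle w y"
    by (auto simp: shuffle_list_def)
  thus ?case using Cons.IH[OF y(1)] by (auto simp: set_mset_shuffle length_shuffles)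
qed (simp add: shuffle_list_def)

text \<open>These are the words shuffled in \<open>I_int\<close>, which depend on its two sequences
  only through their sum \<open>c\<close>.\<close>

definition block_words :: "(nat \<Rightarrow> nat) \<Rightarrow> nat list list" where
  "block_words c = map (\<lambda>i. replicate (c i) i) (sorted_list_of_set {i. c i \<noteq> 0})"

text \<open>Since all words of the shuffle have one length, a single simplex serves for all of
  them.\<close>

lemma length_block_words:
  assumes "finite {i. c i \<noteq> 0}" "z \<in># shuffle_list (block_words c)"
  shows "length z = (\<Sum>i | c i \<noteq> 0. c i)"
  using length_shuffle_list[OF assms(2)] assms(1)
  by (simp add: block_words_def o_def flip: sum.distinct_set_conv_list)

text \<open>Each block yields one factor of the moment, and the product over the blocks is a sum
  over their shuffle.\<close>

lemma scaled_moment_shuffle: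
  assumes f: "continuous_on {0..1} f" and c: "finite {i. c i \<noteq> 0}"
  shows "scaled_moment f c
    = (\<Sum>z\<in>#shuffle_list (block_words c). iterated_integral (\<lambda>i v. f v ^ i) z 0)"
proof -
  have *: "continuous_on {0..1} (\<lambda>v. f v ^ i)" for i
    by (intro continuous_intros f)
  have "path_moment f i = integral {0..1} (\<lambda>v. f v ^ i)" for i
    unfolding path_moment_def
    by (rule set_borel_integral_eq_integral) (rule borel_integrable_atLeastAtMost'[OF *])
  hence "scaled_moment f c = (\<Prod>i | c i \<noteq> 0. iterated_integral (\<lambda>i v. f v ^ i) (replicate (c i) i) 0)"
    by (simp add: scaled_moment_def iterated_integral_replicate[OF *])
  thus ?thesis
    using c by (simp add: iterated_integral_shuffle_list[OF *] block_words_def o_def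
        flip: prod.distinct_set_conv_list)
qed

section \<open>Iterated integrals as integrals over simplices\<close>

text \<open>The new coordinate is integrated outermost, as is needed when it bounds the others from
  below. The index set is split as \<open>{i} \<union> I\<close>, where merging amounts to a
  function update.\<close>

lemma (in product_sigma_finite) product_integral_insert_rev:
  fixes f :: "_ \<Rightarrow> _::{banach, second_countable_topology}"
  assumes I: "finite I" "i \<notin> I"
    and f: "integrable (Pi\<^sub>M (insert i I) M) f"
  shows "integral\<^sup>L (Pi\<^sub>M (insert i I) M) f = (\<integral>y. (\<integral>x. f (x(i := y)) \<partial>Pi\<^sub>M I M) \<partial>M i)"
proof -
  interpret I: finite_product_sigma_finite M I by standard fact
  have [measurable]: "f \<in> borel_measurable (Pi\<^sub>M (insert i I) M)" using f by auto
  have "integral\<^sup>L (Pi\<^sub>M (insert i I) M) f = integral\<^sup>L (Pi\<^sub>M ({i} \<union> I) M) f" by simp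
  also have "\<dots> = (\<integral>x. (\<integral>y. f (merge {i} I (x, y)) \<partial>Pi\<^sub>M I M) \<partial>Pi\<^sub>M {i} M)"
    using f I by (intro product_integral_fold) auto
  also have "\<dots> = (\<integral>x. (\<integral>y. f (y(i := x i)) \<partial>Pi\<^sub>M I M) \<partial>Pi\<^sub>M {i} M)"
  proof (intro Bochner_Integration.integral_cong refl arg_cong[where f=f])
    fix x y assume "x \<in> space (Pi\<^sub>M {i} M)" "y \<in> space (Pi\<^sub>M I M)"
    thus "merge {i} I (x, y) = y(i := x i)"
      using I by (auto simp: merge_def space_PiM PiE_def extensional_def fun_eq_iff)
  qed
  also have "\<dots> = (\<integral>y. (\<integral>x. f (x(i := y)) \<partial>Pi\<^sub>M I M) \<partial>M i)"
    by (rule product_integral_singleton, rule I.borel_measurable_lebesgue_integral) measurable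
  finally show ?thesis .
qed

(* Coordinates are numbered from a so that splitting off the first one leaves a simplex of the same
   form, with no shift of indices. *)
definition simplex_above :: "real \<Rightarrow> nat \<Rightarrow> nat \<Rightarrow> (nat \<Rightarrow> real) set" where
  "simplex_above s a n = {v. (\<forall>j\<in>{a..<a + n}. v j \<in> {s..1}) \<and> mono_on {a..<a + n} v}"

text \<open>The recursion of the simplex that matches \<open>iterated_integral\<close>: the first
  coordinate becomes the lower limit for the others.\<close>

lemma fun_upd_in_simplex_above:
  "v(a := y) \<in> simplex_above s a (Suc n) \<longleftrightarrow> y \<in> {s..1} \<and> v \<in> simplex_above y (Suc a) n"
proof -
  have I: "{a..<a + Suc n} = insert a {Suc a..<Suc a + n}" by auto
  show ?thesis
  proof
    assume "v(a := y) \<in> simplex_above s a (Suc n)"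
    hence 1: "\<And>j. j \<in> {a..<a + Suc n} \<Longrightarrow> (v(a := y)) j \<in> {s..1}"
      and 2: "\<And>i j. i \<in> {a..<a + Suc n} \<Longrightarrow> j \<in> {a..<a + Suc n} \<Longrightarrow> i \<le> j \<Longrightarrow> (v(a := y)) i \<le> (v(a := y)) j"
      by (auto simp: simplex_above_def mono_on_def)
    have "v j \<in> {y..1}" if "j \<in> {Suc a..<Suc a + n}" for j
      using 1[of j] 2[of a j] that by auto
    moreover have "v i \<le> v j" if "i \<in> {Suc a..<Suc a + n}" "j \<in> {Suc a..<Suc a + n}" "i \<le> j" for i j
      using 2[of i j] that by auto
    ultimately show "y \<in> {s..1} \<and> v \<in> simplex_above y (Suc a) n"
      using 1[of a] by (auto simp: simplex_above_def mono_on_def)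
  next
    assume "y \<in> {s..1} \<and> v \<in> simplex_above y (Suc a) n"
    thus "v(a := y) \<in> simplex_above s a (Suc n)"
      unfolding simplex_above_def I by (auto simp: mono_on_def intro: order_trans)
  qed
qed

lemma borel_measurable_component:
  "j \<in> I \<Longrightarrow> (\<lambda>v. v j) \<in> borel_measurable (Pi\<^sub>M I (\<lambda>_. lborel :: real measure))"
  using measurable_component_singleton[of j I "\<lambda>_. lborel :: real measure"] by simp

lemma pred_simplex_above [measurable]:
  "Measurable.pred (Pi\<^sub>M {a..<a + n} (\<lambda>_. lborel)) (\<lambda>v. v \<in> simplex_above s a n)"
proof -
  let ?I = "{a..<a + n}"
  have "v \<in> simplex_above s a n \<longleftrightarrow>
      (\<forall>j\<in>?I. s \<le> v j \<and> v j \<le> 1) \<and> (\<forall>i\<in>?I. \<forall>j\<in>?I. i \<le> j \<longrightarrow> v i \<le> v j)" for v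
    unfolding simplex_above_def mono_on_def by auto
  thus ?thesis
    by (simp only:) (intro pred_intros_logic pred_intros_finite finite_atLeastLessThan
        borel_measurable_le[folded pred_def] borel_measurable_const borel_measurable_component; assumption)
qed

lemma borel_measurable_indicator_simplex_above [measurable]:
  "indicat_real (simplex_above s a n) \<in> borel_measurable (Pi\<^sub>M {a..<a + n} (\<lambda>_. lborel))"
  unfolding indicator_def[abs_def] of_bool_def by (intro measurable_If pred_simplex_above[unfolded pred_def]) auto

text \<open>The integrand is bounded, by compactness of \<open>{0..1}\<close>, and vanishes outside
  the unit cube, which has finite measure. Measurability is asked on the whole line, whereas
  continuity is known on \<open>{0..1}\<close> only.\<close>

lemma integrable_simplex_above:
  fixes g :: "'a \<Rightarrow> real \<Rightarrow> real"
  assumes meas: "\<And>x. g x \<in> borel_measurable borel"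
    and cont: "\<And>x. continuous_on {0..1} (g x)" and s: "0 \<le> s" and w: "length w = n"
  shows "integrable (Pi\<^sub>M {a..<a + n} (\<lambda>_. lborel))
    (\<lambda>v. indicator (simplex_above s a n) v * (\<Prod>j<n. g (w ! j) (v (a + j))))"
proof -
  interpret product_sigma_finite "\<lambda>_::nat. lborel :: real measure" ..
  let ?f = "\<lambda>v. indicator (simplex_above s a n) v * (\<Prod>j<n. g (w ! j) (v (a + j)))"
  let ?box = "PiE {a..<a + n} (\<lambda>_. {0..1::real})"
  have "\<forall>x. \<exists>K. \<forall>v\<in>{0..1}. \<bar>g x v\<bar> \<le> K"
  proof
    fix x
    have "bounded (g x ` {0..1})"
      by (rule compact_imp_bounded[OF compact_continuous_image[OF cont compact_Icc]])
    thus "\<exists>K. \<forall>v\<in>{0..1}. \<bar>g x v\<bar> \<le> K" unfolding bounded_iff by auto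
  qed
  from choice[OF this] obtain K where K: "\<And>x v. v \<in> {0..1} \<Longrightarrow> \<bar>g x v\<bar> \<le> K x" by blast
  have unit: "v j \<in> {0..1}" if "v \<in> simplex_above s a n" "j \<in> {a..<a + n}" for v j
    using that s by (auto simp: simplex_above_def intro: order_trans)
  have bound: "\<bar>?f v\<bar> \<le> (\<Prod>j<n. K (w ! j))" for v
  proof (cases "v \<in> simplex_above s a n")
    case True
    have "\<bar>?f v\<bar> = (\<Prod>j<n. \<bar>g (w ! j) (v (a + j))\<bar>)" using True by (simp add: abs_prod)
    also have "\<dots> \<le> (\<Prod>j<n. K (w ! j))"
      by (intro prod_mono conjI abs_ge_zero K unit[OF True]) auto
    finally show ?thesis .
  next
    case False
    \<comment> \<open>Evaluating the bound at the point 0 shows that \<open>K\<close> is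
      nonnegative.\<close>
    have "0 \<le> (\<Prod>j<n. K (w ! j))"
      by (intro prod_nonneg ballI order_trans[OF abs_ge_zero K[of 0]]) auto
    thus ?thesis using False by simp
  qed
  have zero: "?f v = 0" if "v \<in> space (Pi\<^sub>M {a..<a + n} (\<lambda>_. lborel :: real measure))" "v \<notin> ?box" for v
  proof -
    have "v \<notin> simplex_above s a n"
      using that unit by (auto simp: space_PiM PiE_iff)
    thus ?thesis by simp
  qed
  show ?thesis
  proof (rule integrableI_bounded_set)
    show "?box \<in> sets (Pi\<^sub>M {a..<a + n} (\<lambda>_. lborel))" by (intro sets_PiM_I_finite) auto
    show "emeasure (Pi\<^sub>M {a..<a + n} (\<lambda>_. lborel)) ?box < \<infinity>"
      by (subst emeasure_PiM) auto
    show "?f \<in> borel_measurable (Pi\<^sub>M {a..<a + n} (\<lambda>_. lborel))"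
      by (intro borel_measurable_times borel_measurable_prod borel_measurable_indicator_simplex_above
        measurable_compose[OF borel_measurable_component meas]) auto
    show "AE v in Pi\<^sub>M {a..<a + n} (\<lambda>_. lborel). v \<in> ?box \<longrightarrow> norm (?f v) \<le> (\<Prod>j<n. K (w ! j))"
      unfolding real_norm_def by (intro AE_I2 impI bound)
    show "AE v in Pi\<^sub>M {a..<a + n} (\<lambda>_. lborel). v \<notin> ?box \<longrightarrow> ?f v = 0"
      by (intro AE_I2 impI zero)
  qed
qed

text \<open>Induction on the word for all \<open>s\<close> and \<open>a\<close>: with the first
  coordinate \<open>y\<close> outermost, the inner integral is the instance with lower limit
  \<open>y\<close> and first index \<open>Suc a\<close>.\<close>

lemma integral_simplex_above:
  fixes g :: "'a \<Rightarrow> real \<Rightarrow> real"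
  assumes meas: "\<And>x. g x \<in> borel_measurable borel"
    and cont: "\<And>x. continuous_on {0..1} (g x)"
  shows "s \<in> {0..1} \<Longrightarrow>
    (\<integral>v. indicator (simplex_above s a (length w)) v * (\<Prod>j<length w. g (w ! j) (v (a + j))) \<partial>(Pi\<^sub>M {a..<a + length w} (\<lambda>_. lborel)))
    = iterated_integral g w s"
proof (induction w arbitrary: s a)
  case Nil
  interpret product_sigma_finite "\<lambda>_::nat. lborel :: real measure" ..
  \<comment> \<open>In dimension 0 the product measure is a point mass, and both sides are
    1.\<close>
  show ?case by (simp add: simplex_above_def mono_on_def PiM_empty lebesgue_integral_count_space_finite)
next
  case (Cons x xs)
  interpret product_sigma_finite "\<lambda>_::nat. lborel :: real measure" ..
  let ?n = "length xs"
  let ?F = "\<lambda>v. indicator (simplex_above s a (Suc ?n)) v * (\<Prod>j<Suc ?n. g ((x # xs) ! j) (v (a + j)))"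
  have I: "{a..<a + Suc ?n} = insert a {Suc a..<Suc a + ?n}" by auto
  have "integrable (Pi\<^sub>M {a..<a + Suc ?n} (\<lambda>_. lborel)) ?F"
    by (rule integrable_simplex_above[OF meas cont]) (use Cons.prems in auto)
  hence "integral\<^sup>L (Pi\<^sub>M {a..<a + Suc ?n} (\<lambda>_. lborel)) ?F
      = (\<integral>y. (\<integral>v. ?F (v(a := y)) \<partial>Pi\<^sub>M {Suc a..<Suc a + ?n} (\<lambda>_. lborel)) \<partial>lborel)"
    unfolding I by (intro product_integral_insert_rev) auto
  also have "\<dots> = (\<integral>y. indicator {s..1} y * (g x y * iterated_integral g xs y) \<partial>lborel)"
  proof (rule Bochner_Integration.integral_cong[OF refl])
    fix y :: real
    have "?F (v(a := y)) = indicator {s..1} y * g x y *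
       (indicator (simplex_above y (Suc a) ?n) v * (\<Prod>j<?n. g (xs ! j) (v (Suc a + j))))" for v
      unfolding prod.lessThan_Suc_shift indicator_def fun_upd_in_simplex_above by simp
    moreover have "y \<in> {s..1} \<Longrightarrow> y \<in> {0..1}" using Cons.prems by auto
    ultimately show "(\<integral>v. ?F (v(a := y)) \<partial>Pi\<^sub>M {Suc a..<Suc a + ?n} (\<lambda>_. lborel))
        = indicator {s..1} y * (g x y * iterated_integral g xs y)"
      using Cons.IH[of y "Suc a"] by (simp split: split_indicator)
  qed
  also have "\<dots> = iterated_integral g (x # xs) s"
  proof -
    have "continuous_on {s..1} (\<lambda>y. g x y * iterated_integral g xs y)"
      using Cons.prems
      by (intro continuous_intros continuous_on_subset[OF cont]
          continuous_on_subset[OF continuous_on_iterated_integral[OF cont]]) auto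
    from set_borel_integral_eq_integral(2)[OF borel_integrable_atLeastAtMost'[OF this]]
    show ?thesis by (simp add: set_lebesgue_integral_def)
  qed
  finally show ?case unfolding length_Cons .
qed

text \<open>Points of the product space are extensional, and extensionality is all that separates
  the two sets.\<close>

lemma indicator_ordered_simplex:
  assumes "v \<in> space (Pi\<^sub>M {..<n} (\<lambda>_. lborel :: real measure))"
  shows "indicat_real (ordered_simplex n) v = indicator (simplex_above 0 0 n) v"
proof -
  have "v \<in> ordered_simplex n \<longleftrightarrow> v \<in> simplex_above 0 0 n"
    using assms by (auto simp: ordered_simplex_def simplex_above_def space_PiM PiE_iff lessThan_atLeast0)
  thus ?thesis by (simp add: indicator_def)
qed

section \<open>Expectations over the Brownian bridge\<close>

text \<open>Reduces mixed moments to even moments of single variables, by comparison with the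
  largest \<open>\<bar>y j\<bar>\<close>.\<close>

lemma prod_power_le_sum_power:
  fixes y :: "'a \<Rightarrow> real"
  assumes "finite J"
  shows "(\<Prod>j\<in>J. \<bar>y j\<bar> ^ w j) \<le> 1 + (\<Sum>j\<in>J. y j ^ (2 * sum w J))"
proof -
  \<comment> \<open>Including 1 gives \<open>m \<ge> 1\<close>, so that the exponent may be doubled;
    it accounts for the summand 1 in the bound.\<close>
  define m where "m = Max (insert 1 ((\<lambda>j. \<bar>y j\<bar>) ` J))"
  have fin: "finite (insert 1 ((\<lambda>j. \<bar>y j\<bar>) ` J))" using assms by simp
  have m1: "1 \<le> m" unfolding m_def by (rule Max_ge[OF fin]) simp
  have "\<bar>y j\<bar> \<le> m" if "j \<in> J" for j
    unfolding m_def by (rule Max_ge[OF fin]) (use that in simp)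
  hence "(\<Prod>j\<in>J. \<bar>y j\<bar> ^ w j) \<le> (\<Prod>j\<in>J. m ^ w j)"
    by (intro prod_mono conjI power_mono) auto
  also have "\<dots> = m ^ sum w J" by (rule power_sum[symmetric])
  also have "\<dots> \<le> m ^ (2 * sum w J)" by (rule power_increasing) (use m1 in auto)
  also have "\<dots> \<le> 1 + (\<Sum>j\<in>J. y j ^ (2 * sum w J))"
  proof -
    have nonneg: "0 \<le> y j ^ (2 * sum w J)" for j by (simp add: zero_le_even_power)
    have "m \<in> insert 1 ((\<lambda>j. \<bar>y j\<bar>) ` J)" unfolding m_def by (rule Max_in[OF fin]) simp
    then consider "m = 1" | j where "j \<in> J" "m = \<bar>y j\<bar>" by blast
    thus ?thesis
    proof cases
      case 1
      thus ?thesis using sum_nonneg[of J "\<lambda>j. y j ^ (2 * sum w J)"] nonneg by simp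
    next
      case 2
      have "y j ^ (2 * sum w J) \<le> (\<Sum>j\<in>J. y j ^ (2 * sum w J))"
        by (rule member_le_sum) (use 2 nonneg assms in auto)
      thus ?thesis using 2 by (simp add: power_even_abs)
    qed
  qed
  finally show ?thesis .
qed

context brownian_bridge
begin

lemma borel_measurable_bridge: "s \<in> {0..1} \<Longrightarrow> \<alpha> s \<in> borel_measurable \<Omega>"
  using gaussian[of "{s}" "\<lambda>_. 1"] by (simp add: centered_gaussian_def)

text \<open>The variance \<open>s * (1 - s)\<close> is at most 1, so the moments are bounded by
  those of a standard Gaussian, uniformly in \<open>s\<close>.\<close>

lemma even_moment_bridge:
  assumes s: "s \<in> {0..1}"
  shows "integrable \<Omega> (\<lambda>\<omega>. \<alpha> s \<omega> ^ (2 * k))"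
    and "expectation (\<lambda>\<omega>. \<alpha> s \<omega> ^ (2 * k)) \<le> fact (2 * k) / (2 ^ k * fact k)"
proof -
  note meas = borel_measurable_bridge[OF s]
  have "centered_gaussian \<Omega> (\<alpha> s)" using gaussian[of "{s}" "\<lambda>_. 1"] s by simp
  then consider "AE \<omega> in \<Omega>. \<alpha> s \<omega> = 0"
    | \<sigma> where "\<sigma> > 0" "distributed \<Omega> lborel (\<alpha> s) (normal_density 0 \<sigma>)"
    unfolding centered_gaussian_def by blast
  hence "integrable \<Omega> (\<lambda>\<omega>. \<alpha> s \<omega> ^ (2 * k)) \<and>
    expectation (\<lambda>\<omega>. \<alpha> s \<omega> ^ (2 * k)) \<le> fact (2 * k) / (2 ^ k * fact k)"
  proof cases
    case 1
    \<comment> \<open>The value is kept as a power of 0 because the moment of order 0 is 1.\<close>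
    have "AE \<omega> in \<Omega>. \<alpha> s \<omega> ^ (2 * k) = 0 ^ (2 * k)" using 1 by eventually_elim simp
    hence "integrable \<Omega> (\<lambda>\<omega>. \<alpha> s \<omega> ^ (2 * k)) \<longleftrightarrow> integrable \<Omega> (\<lambda>\<omega>. 0 ^ (2 * k) :: real)"
      "expectation (\<lambda>\<omega>. \<alpha> s \<omega> ^ (2 * k)) = expectation (\<lambda>\<omega>. 0 ^ (2 * k) :: real)"
      using meas by (intro integrable_cong_AE integral_cong_AE; simp)+
    thus ?thesis by (cases k) (simp_all add: prob_space)
  next
    case 2
    have int: "integrable lborel (\<lambda>x. normal_density 0 \<sigma> x * x ^ (2 * k))" for k
      using integrable.intros[OF normal_moment_even[OF 2(1), of 0 k]] by simp
    have moment: "integrable \<Omega> (\<lambda>\<omega>. \<alpha> s \<omega> ^ (2 * k))"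
      "expectation (\<lambda>\<omega>. \<alpha> s \<omega> ^ (2 * k)) = fact (2 * k) / ((2 / \<sigma>\<^sup>2) ^ k * fact k)" for k
      using distributed_integrable[OF 2(2), of "\<lambda>x. x ^ (2 * k)"] int[of k]
        distributed_integral[OF 2(2), of "\<lambda>x. x ^ (2 * k)"] integral_normal_moment_even[OF 2(1), of 0 k]
      by simp_all
    \<comment> \<open>The case \<open>k = 1\<close> of the moment formula identifies
      \<open>\<sigma>\<^sup>2\<close> with the variance prescribed by the covariance.\<close>
    have "\<sigma>\<^sup>2 = expectation (\<lambda>\<omega>. \<alpha> s \<omega> * \<alpha> s \<omega>)"
      using moment(2)[of 1] by (simp add: power2_eq_square fact_2)
    also have "\<dots> = s * (1 - s)" using s by (intro covariance) auto
    also have "\<dots> \<le> 1" using s by (simp add: mult_le_one)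
    finally have "(\<sigma>\<^sup>2) ^ k \<le> 1" by (simp add: power_le_one)
    hence "fact (2 * k) * (\<sigma>\<^sup>2) ^ k / (2 ^ k * fact k) \<le> fact (2 * k) * 1 / (2 ^ k * fact k)"
      by (intro divide_right_mono mult_left_mono) auto
    thus ?thesis using moment[of k] by (simp add: power_divide)
  qed
  thus "integrable \<Omega> (\<lambda>\<omega>. \<alpha> s \<omega> ^ (2 * k))"
    "expectation (\<lambda>\<omega>. \<alpha> s \<omega> ^ (2 * k)) \<le> fact (2 * k) / (2 ^ k * fact k)" by auto
qed

(* The bridge extended to the real line, so that its paths are continuous everywhere. *)
definition clamped :: "real \<Rightarrow> 'w \<Rightarrow> real" where
  "clamped v = \<alpha> (max 0 (min 1 v))"

lemma clamped_eq: "v \<in> {0..1} \<Longrightarrow> clamped v = \<alpha> v"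
  by (simp add: clamped_def)

lemma continuous_on_clamped:
  assumes "\<omega> \<in> space \<Omega>"
  shows "continuous_on S (\<lambda>v. clamped v \<omega>)"
  unfolding clamped_def
  by (rule continuous_on_compose2[OF continuous_paths[OF assms]]) (auto intro!: continuous_intros)

lemma borel_measurable_clamped: "clamped v \<in> borel_measurable \<Omega>"
  unfolding clamped_def by (rule borel_measurable_bridge) auto

lemma borel_measurable_pair_clamped:
  "(\<lambda>(v, \<omega>). clamped v \<omega>) \<in> borel_measurable (borel \<Otimes>\<^sub>M \<Omega>)"
proof -
  (* A process with continuous paths is jointly measurable: sample it at finer and finer grids. *)
  define q where "q n v = of_int \<lfloor>real (Suc n) * v\<rfloor> / real (Suc n)" for n and v :: real
  have q: "(\<lambda>n. q n v) \<longlonglongrightarrow> v" for v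
  proof (rule tendsto_sandwich)
    show "\<forall>\<^sub>F n in sequentially. v - 1 / real (Suc n) \<le> q n v"
    proof (rule always_eventually, rule allI)
      fix n
      have "real (Suc n) * v - 1 \<le> of_int \<lfloor>real (Suc n) * v\<rfloor>" by linarith
      hence "(real (Suc n) * v - 1) / real (Suc n) \<le> q n v"
        unfolding q_def by (intro divide_right_mono) auto
      thus "v - 1 / real (Suc n) \<le> q n v" by (simp add: diff_divide_distrib del: of_nat_Suc)
    qed
    show "\<forall>\<^sub>F n in sequentially. q n v \<le> v"
    proof (rule always_eventually, rule allI)
      fix n
      have "q n v \<le> (real (Suc n) * v) / real (Suc n)"
        unfolding q_def by (intro divide_right_mono) auto
      thus "q n v \<le> v" by (simp del: of_nat_Suc)
    qed
    show "(\<lambda>n. v - 1 / real (Suc n)) \<longlonglongrightarrow> v"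
      using tendsto_diff[OF tendsto_const[of v] LIMSEQ_inverse_real_of_nat]
      by (simp add: inverse_eq_divide)
  qed simp
  \<comment> \<open>On each grid only countably many times occur, so measurability at fixed times
    suffices.\<close>
  have meas: "(\<lambda>(v, \<omega>). clamped (q n v) \<omega>) \<in> borel_measurable (borel \<Otimes>\<^sub>M \<Omega>)" for n
  proof -
    have a: "(\<lambda>p. clamped (of_int i / real (Suc n)) (snd p)) \<in> borel_measurable (borel \<Otimes>\<^sub>M \<Omega>)" for i :: int
      by (rule measurable_compose[OF measurable_snd borel_measurable_clamped])
    have "(\<lambda>x::real. \<lfloor>real (Suc n) * x\<rfloor>) \<in> measurable borel (count_space UNIV)"
      by measurable
    hence b: "(\<lambda>p. \<lfloor>real (Suc n) * fst p\<rfloor>) \<in> measurable (borel \<Otimes>\<^sub>M \<Omega>) (count_space UNIV)"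
      by (rule measurable_compose[OF measurable_fst])
    from measurable_compose_countable[OF a b] show ?thesis by (simp add: q_def split_beta' del: of_nat_Suc)
  qed
  have lim: "(\<lambda>n. (\<lambda>(v, \<omega>). clamped (q n v) \<omega>) p) \<longlonglongrightarrow> (\<lambda>(v, \<omega>). clamped v \<omega>) p"
    if "p \<in> space (borel \<Otimes>\<^sub>M \<Omega>)" for p
  proof -
    obtain v \<omega> where p: "p = (v, \<omega>)" "\<omega> \<in> space \<Omega>" using \<open>p \<in> _\<close> by (auto simp: space_pair_measure)
    have "isCont (\<lambda>v. clamped v \<omega>) v"
      using continuous_on_clamped[OF p(2), of UNIV] by (simp add: continuous_on_eq_continuous_at)
    from isCont_tendsto_compose[OF this q[of v]] show ?thesis by (simp add: p(1))
  qed
  show ?thesis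
    by (rule borel_measurable_LIMSEQ_real[where u="\<lambda>n (v, \<omega>). clamped (q n v) \<omega>", OF lim meas])
qed

lemma clamped_even_moment:
  "integrable \<Omega> (\<lambda>\<omega>. clamped v \<omega> ^ (2 * k))"
  "expectation (\<lambda>\<omega>. clamped v \<omega> ^ (2 * k)) \<le> fact (2 * k) / (2 ^ k * fact k)"
  unfolding clamped_def by (rule even_moment_bridge; simp)+

text \<open>Even powers dominate the product. The bound depends on the word but not on
  \<open>v\<close>, as integration over the simplex requires.\<close>

lemma clamped_prod_moment:
  fixes v :: "nat \<Rightarrow> real" and w :: "nat list"
  defines "K \<equiv> (\<Sum>j<length w. w ! j)"
  shows "integrable \<Omega> (\<lambda>\<omega>. \<Prod>j<length w. clamped (v j) \<omega> ^ (w ! j))" (is "integrable \<Omega> ?f")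
    and "expectation (\<lambda>\<omega>. \<bar>\<Prod>j<length w. clamped (v j) \<omega> ^ (w ! j)\<bar>)
      \<le> 1 + real (length w) * (fact (2 * K) / (2 ^ K * fact K))"
proof -
  let ?g = "\<lambda>\<omega>. 1 + (\<Sum>j<length w. clamped (v j) \<omega> ^ (2 * K))"
  have g: "integrable \<Omega> ?g"
    by (intro Bochner_Integration.integrable_add Bochner_Integration.integrable_sum clamped_even_moment) simp
  have le: "\<bar>?f \<omega>\<bar> \<le> ?g \<omega>" for \<omega>
    using prod_power_le_sum_power[of "{..<length w}" "\<lambda>j. clamped (v j) \<omega>" "\<lambda>j. w ! j"]
    by (simp add: abs_prod power_abs K_def)
  have meas: "?f \<in> borel_measurable \<Omega>"
    by (intro borel_measurable_prod borel_measurable_power borel_measurable_clamped)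
  show f: "integrable \<Omega> ?f"
    by (rule Bochner_Integration.integrable_bound[OF g meas], rule AE_I2)
      (use le in \<open>force intro: order_trans[OF le abs_ge_self]\<close>)
  have "expectation (\<lambda>\<omega>. \<bar>?f \<omega>\<bar>) \<le> expectation ?g"
    by (rule integral_mono[OF integrable_abs[OF f] g le])
  also have "\<dots> = 1 + (\<Sum>j<length w. expectation (\<lambda>\<omega>. clamped (v j) \<omega> ^ (2 * K)))"
    by (subst Bochner_Integration.integral_add)
      (auto simp: prob_space intro!: Bochner_Integration.integrable_sum clamped_even_moment Bochner_Integration.integral_sum)
  also have "\<dots> \<le> 1 + (\<Sum>j<length w. fact (2 * K) / (2 ^ K * fact K))"
    by (intro add_left_mono sum_mono clamped_even_moment)
  finally show "expectation (\<lambda>\<omega>. \<bar>?f \<omega>\<bar>) \<le> 1 + real (length w) * (fact (2 * K) / (2 ^ K * fact K))"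
    by simp
qed

section \<open>Exchanging the expectation with the integral over the simplex\<close>

text \<open>The expected absolute value is at most a constant times the indicator of the simplex,
  which has finite volume.\<close>

lemma integrable_pair_simplex:
  fixes w :: "nat list"
  defines "n \<equiv> length w"
  shows "integrable (Pi\<^sub>M {..<n} (\<lambda>_. lborel) \<Otimes>\<^sub>M \<Omega>)
    (\<lambda>(v, \<omega>). indicator (simplex_above 0 0 n) v * (\<Prod>j<n. clamped (v j) \<omega> ^ (w ! j)))"
proof -
  let ?P = "Pi\<^sub>M {..<n} (\<lambda>_. lborel :: real measure)"
  let ?ind = "indicat_real (simplex_above 0 0 n)"
  let ?f = "\<lambda>(v, \<omega>). ?ind v * (\<Prod>j<n. clamped (v j) \<omega> ^ (w ! j))"
  interpret product_sigma_finite "\<lambda>_::nat. lborel :: real measure" ..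
  interpret P: sigma_finite_measure ?P by (rule sigma_finite) simp
  interpret pair_sigma_finite ?P \<Omega> ..
  have ind: "?ind \<in> borel_measurable ?P"
    using borel_measurable_indicator_simplex_above[of 0 0 n] by (simp add: lessThan_atLeast0)
  have clamped_comp: "(\<lambda>p. clamped (fst p j) (snd p)) \<in> borel_measurable (?P \<Otimes>\<^sub>M \<Omega>)" if "j < n" for j
  proof -
    have "(\<lambda>p. (fst p j, snd p)) \<in> measurable (?P \<Otimes>\<^sub>M \<Omega>) (borel \<Otimes>\<^sub>M \<Omega>)"
      by (intro measurable_Pair measurable_compose[OF measurable_fst borel_measurable_component]) (use that in auto)
    from measurable_compose[OF this borel_measurable_pair_clamped] show ?thesis by simp
  qed
  have meas: "?f \<in> borel_measurable (?P \<Otimes>\<^sub>M \<Omega>)"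
    unfolding split_beta'
    by (intro borel_measurable_times borel_measurable_prod borel_measurable_power clamped_comp
        measurable_compose[OF measurable_fst ind]) auto
  define C where "C = 1 + real n * (fact (2 * (\<Sum>j<n. w ! j)) / (2 ^ (\<Sum>j<n. w ! j) * fact (\<Sum>j<n. w ! j)))"
  have norm_f: "(\<integral>\<omega>. norm (?f (v, \<omega>)) \<partial>\<Omega>) = ?ind v * expectation (\<lambda>\<omega>. \<bar>\<Prod>j<n. clamped (v j) \<omega> ^ (w ! j)\<bar>)" for v
    by (simp add: abs_mult)
  \<comment> \<open>Finite volume is the case of constant functions 1 in the integrability lemma;
    the word of zeros only supplies the length.\<close>
  have int_ind: "integrable ?P ?ind"
    using integrable_simplex_above[of "\<lambda>(x::nat) v. 1" 0 "replicate n 0" n 0] by (simp add: lessThan_atLeast0)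
  show ?thesis
  proof (rule Fubini_integrable[OF meas])
    show "AE v in ?P. integrable \<Omega> (\<lambda>\<omega>. ?f (v, \<omega>))"
      unfolding n_def by (auto intro!: AE_I2 clamped_prod_moment)
    show "integrable ?P (\<lambda>v. \<integral>\<omega>. norm (?f (v, \<omega>)) \<partial>\<Omega>)"
    proof (rule Bochner_Integration.integrable_bound[OF integrable_mult_left[OF int_ind, of C]])
      have "sigma_finite_measure \<Omega>" by unfold_locales
      moreover have "(\<lambda>(v, \<omega>). norm (?f (v, \<omega>))) \<in> borel_measurable (?P \<Otimes>\<^sub>M \<Omega>)" using meas by simp
      ultimately show "(\<lambda>v. \<integral>\<omega>. norm (?f (v, \<omega>)) \<partial>\<Omega>) \<in> borel_measurable ?P"
        by (rule sigma_finite_measure.borel_measurable_lebesgue_integral)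
      show "AE v in ?P. norm (\<integral>\<omega>. norm (?f (v, \<omega>)) \<partial>\<Omega>) \<le> norm (?ind v * C)"
      proof (rule AE_I2)
        fix v
        let ?E = "expectation (\<lambda>\<omega>. \<bar>\<Prod>j<n. clamped (v j) \<omega> ^ (w ! j)\<bar>)"
        have "0 \<le> ?E" by (rule Bochner_Integration.integral_nonneg) simp
        moreover have "?E \<le> C" unfolding C_def n_def by (rule clamped_prod_moment)
        ultimately have "\<bar>?E\<bar> \<le> \<bar>C\<bar>" by linarith
        thus "norm (\<integral>\<omega>. norm (?f (v, \<omega>)) \<partial>\<Omega>) \<le> norm (?ind v * C)"
          unfolding norm_f unfolding real_norm_def abs_mult by (intro mult_left_mono) auto
      qed
    qed
  qed
qed

text \<open>Both values are iterated integrals, in the two orders, of one integrable function on the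
  product of coordinate space and path space.\<close>

lemma iterated_integral_expectation:
  fixes w :: "nat list"
  defines "J \<equiv> \<lambda>\<omega>. iterated_integral (\<lambda>i v. clamped v \<omega> ^ i) w 0"
  shows "integrable \<Omega> J"
    and "set_integrable (Pi\<^sub>M {..<length w} (\<lambda>_. lborel)) (ordered_simplex (length w)) (\<lambda>v. V_word \<Omega> \<alpha> v w)"
    and "(LINT v:ordered_simplex (length w)|(Pi\<^sub>M {..<length w} (\<lambda>_. lborel)). V_word \<Omega> \<alpha> v w) = expectation J"
proof -
  let ?n = "length w"
  let ?P = "Pi\<^sub>M {..<?n} (\<lambda>_. lborel :: real measure)"
  let ?f = "\<lambda>v \<omega>. indicator (simplex_above 0 0 ?n) v * (\<Prod>j<?n. clamped (v j) \<omega> ^ (w ! j))"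
  interpret product_sigma_finite "\<lambda>_::nat. lborel :: real measure" ..
  interpret P: sigma_finite_measure ?P by (rule sigma_finite) simp
  interpret pair_sigma_finite ?P \<Omega> ..
  note int = integrable_pair_simplex[of w]
  have J: "J \<omega> = (\<integral>v. ?f v \<omega> \<partial>?P)" if "\<omega> \<in> space \<Omega>" for \<omega>
  proof -
    have "continuous_on S (\<lambda>v. clamped v \<omega> ^ i)" for i S
      by (intro continuous_intros continuous_on_clamped that)
    moreover from this[of UNIV] have "(\<lambda>v. clamped v \<omega> ^ i) \<in> borel_measurable borel" for i
      by (intro borel_measurable_continuous_onI)
    ultimately show ?thesis
      using integral_simplex_above[of "\<lambda>i v. clamped v \<omega> ^ i" 0 0 w] by (simp add: J_def lessThan_atLeast0)
  qed
  \<comment> \<open>On the simplex all coordinates lie in \<open>{0..1}\<close>, where clamping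
    changes nothing; elsewhere both sides are 0.\<close>
  have V: "indicator (ordered_simplex ?n) v *\<^sub>R V_word \<Omega> \<alpha> v w = (\<integral>\<omega>. ?f v \<omega> \<partial>\<Omega>)" if "v \<in> space ?P" for v
  proof (cases "v \<in> simplex_above 0 0 ?n")
    case True
    hence "v j \<in> {0..1}" if "j < ?n" for j using that by (auto simp: simplex_above_def)
    hence "(\<Prod>j<?n. \<alpha> (v j) \<omega> ^ (w ! j)) = (\<Prod>j<?n. clamped (v j) \<omega> ^ (w ! j))" for \<omega>
      by (intro prod.cong) (simp_all add: clamped_eq)
    thus ?thesis using True by (simp add: indicator_ordered_simplex[OF that] V_word_def)
  qed (simp add: indicator_ordered_simplex[OF that])
  show "integrable \<Omega> J"
    using integrable_snd[OF int] by (rule Bochner_Integration.integrable_cong[THEN iffD2, rotated 2]) (simp_all add: J)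
  show "set_integrable ?P (ordered_simplex ?n) (\<lambda>v. V_word \<Omega> \<alpha> v w)"
    unfolding set_integrable_def
    using integrable_fst[OF int] by (rule Bochner_Integration.integrable_cong[THEN iffD2, rotated 2]) (simp_all only: V)
  have "(LINT v:ordered_simplex ?n|?P. V_word \<Omega> \<alpha> v w) = (\<integral>v. (\<integral>\<omega>. ?f v \<omega> \<partial>\<Omega>) \<partial>?P)"
    unfolding set_lebesgue_integral_def by (intro Bochner_Integration.integral_cong refl V)
  also have "\<dots> = (\<integral>\<omega>. (\<integral>v. ?f v \<omega> \<partial>?P) \<partial>\<Omega>)"
    by (rule Fubini_integral[OF int, symmetric])
  also have "\<dots> = expectation J"
    by (intro Bochner_Integration.integral_cong refl J[symmetric])
  finally show "(LINT v:ordered_simplex ?n|?P. V_word \<Omega> \<alpha> v w) = expectation J" .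
qed

text \<open>For each path the moment is a sum over the words of a shuffle, and both integrations are
  linear in this sum.\<close>

lemma scaled_moment_expectation:
  assumes "finite {i. l i + m i \<noteq> 0}"
  shows "integrable \<Omega> (\<lambda>\<omega>. scaled_moment (\<lambda>v. \<alpha> v \<omega>) (\<lambda>i. l i + m i))"
    and "expectation (\<lambda>\<omega>. scaled_moment (\<lambda>v. \<alpha> v \<omega>) (\<lambda>i. l i + m i)) = I_int \<Omega> \<alpha> l m"
proof -
  define c where "c i = l i + m i" for i
  define N where "N = (\<Sum>i | c i \<noteq> 0. c i)"
  define S where "S = shuffle_list (block_words c)"
  define J where "J z \<omega> = iterated_integral (\<lambda>i v. clamped v \<omega> ^ i) z 0" for z \<omega>
  have fin: "finite {i. c i \<noteq> 0}" using assms by (simp add: c_def)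
  have len: "length z = N" if "z \<in># S" for z
    using length_block_words[OF fin] that by (simp add: S_def N_def)
  have sum_int: "integrable \<Omega> (\<lambda>\<omega>. \<Sum>z\<in>#T. J z \<omega>)"
    and sum_exp: "expectation (\<lambda>\<omega>. \<Sum>z\<in>#T. J z \<omega>) = (\<Sum>z\<in>#T. expectation (J z))" for T
    using iterated_integral_expectation(1) by (induction T) (simp_all add: J_def[abs_def])
  \<comment> \<open>Integrability is carried through the induction because additivity of the
    integral needs it; the common length \<open>N\<close> keeps the domain fixed.\<close>
  have V: "set_integrable (Pi\<^sub>M {..<N} (\<lambda>_. lborel)) (ordered_simplex N) (\<lambda>v. V_lin \<Omega> \<alpha> v T) \<and>
      (LINT v:ordered_simplex N|(Pi\<^sub>M {..<N} (\<lambda>_. lborel)). V_lin \<Omega> \<alpha> v T) = (\<Sum>z\<in>#T. expectation (J z))"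
    if "\<And>z. z \<in># T \<Longrightarrow> length z = N" for T
    using that
  proof (induction T)
    case empty
    show ?case by (simp add: V_lin_def set_integrable_def set_lebesgue_integral_def)
  next
    case (add z T)
    have z: "length z = N" using add.prems by simp
    note IH = add.IH[OF add.prems]
    have "V_lin \<Omega> \<alpha> v (add_mset z T) = V_word \<Omega> \<alpha> v z + V_lin \<Omega> \<alpha> v T" for v
      by (simp add: V_lin_def)
    thus ?case using IH iterated_integral_expectation(2,3)[of z]
      unfolding z by (simp add: set_integral_add J_def[abs_def])
  qed
  have moment: "scaled_moment (\<lambda>v. \<alpha> v \<omega>) c = (\<Sum>z\<in>#S. J z \<omega>)" if "\<omega> \<in> space \<Omega>" for \<omega>
  proof -
    have "path_moment (\<lambda>v. \<alpha> v \<omega>) i = path_moment (\<lambda>v. clamped v \<omega>) i" for i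
      unfolding path_moment_def by (rule set_lebesgue_integral_cong) (auto simp: clamped_eq)
    hence "scaled_moment (\<lambda>v. \<alpha> v \<omega>) c = scaled_moment (\<lambda>v. clamped v \<omega>) c"
      by (simp add: scaled_moment_def)
    thus ?thesis
      unfolding S_def J_def by (simp add: scaled_moment_shuffle[OF continuous_on_clamped[OF that] fin])
  qed
  have "integrable \<Omega> (\<lambda>\<omega>. scaled_moment (\<lambda>v. \<alpha> v \<omega>) c)"
    using sum_int[of S] by (rule Bochner_Integration.integrable_cong[THEN iffD2, rotated 2]) (simp_all add: moment)
  thus "integrable \<Omega> (\<lambda>\<omega>. scaled_moment (\<lambda>v. \<alpha> v \<omega>) (\<lambda>i. l i + m i))" by (simp add: c_def[abs_def])
  have "expectation (\<lambda>\<omega>. scaled_moment (\<lambda>v. \<alpha> v \<omega>) c) = expectation (\<lambda>\<omega>. \<Sum>z\<in>#S. J z \<omega>)"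
    by (intro Bochner_Integration.integral_cong refl moment)
  also have "\<dots> = (LINT v:ordered_simplex N|(Pi\<^sub>M {..<N} (\<lambda>_. lborel)). V_lin \<Omega> \<alpha> v S)"
    using V[of S] len sum_exp by simp
  also have "\<dots> = I_int \<Omega> \<alpha> l m"
    unfolding I_int_def Let_def S_def N_def block_words_def c_def ..
  finally show "expectation (\<lambda>\<omega>. scaled_moment (\<lambda>v. \<alpha> v \<omega>) (\<lambda>i. l i + m i)) = I_int \<Omega> \<alpha> l m"
    by (simp add: c_def[abs_def])
qed

end

section \<open>Expected coefficients and the final formula\<close>

text \<open>For every path the coefficient is the same finite linear combination of scaled moments,
  so the expectation acts on these alone.\<close>

lemma (in brownian_bridge) has_bochner_integral_C_coeff:
  assumes "B t > 0"
  shows "has_bochner_integral \<Omega> (\<lambda>\<omega>. C_coeff A B t (\<lambda>v. \<alpha> v \<omega>) r m (2 * M))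
    (\<Sum>k\<le>2*M. \<Sum>p\<le>2*M. \<Sum>n\<le>M. \<Sum>\<beta>\<le>2*M - 2*n. \<Sum>l\<in>int_seqs \<beta> k. \<Sum>l'\<in>int_seqs (2*M - 2*n - \<beta>) p.
      ((r - real n) gchoose k) * real ((2*n + m) choose p) * fact k * fact p * 2 ^ (M - n) / (4 ^ n * fact n)
      * B t powr (r - real n - real k) * (deriv A t) ^ (2*n + m - p) * P_prod A B t l l'
      * I_int \<Omega> \<alpha> l l')"
proof -
  have moment: "has_bochner_integral \<Omega> (\<lambda>\<omega>. scaled_moment (\<lambda>v. \<alpha> v \<omega>) (\<lambda>i. l i + l' i)) (I_int \<Omega> \<alpha> l l')"
    if "l \<in> int_seqs d k" "l' \<in> int_seqs d' k'" for l l' d d' k k'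
  proof -
    have "finite {i. l i + l' i \<noteq> 0}"
      by (rule finite_subset[of _ "{i. l i \<noteq> 0} \<union> {i. l' i \<noteq> 0}"]) (use that in \<open>auto simp: int_seqs_def\<close>)
    from scaled_moment_expectation[OF this] show ?thesis
      by (simp add: has_bochner_integral_iff)
  qed
  \<comment> \<open>This makes the constant terms of both series deterministic.\<close>
  have "path_moment (\<lambda>v. \<alpha> v \<omega>) 0 = 1" for \<omega>
    by (simp add: path_moment_def set_lebesgue_integral_def)
  note expand = C_coeff_expand[where B=B and t=t, OF assms this]
  show ?thesis
    unfolding expand by (intro has_bochner_integral_sum has_bochner_integral_mult_right moment)
qed

theorem theorem4p15:
  fixes \<Omega> :: "'w measure" and \<alpha> :: "real \<Rightarrow> 'w \<Rightarrow> real"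
    and a A B :: "real \<Rightarrow> real" and M :: nat and t :: real
  assumes bridge: "brownian_bridge \<Omega> \<alpha>"
    and a_pos: "\<And>s. a s > 0"
    and a_smooth: "smooth a"
    and A_eq: "A = (\<lambda>s. 1 / a s)"
    and B_eq: "B = (\<lambda>s. (A s)\<^sup>2)"
    and M_ge: "M \<ge> 1"
  shows "heat_coeff \<Omega> \<alpha> a M t =
    1/2 * (\<Sum>k\<le>2*M. \<Sum>p\<le>2*M. \<Sum>n\<le>M. \<Sum>\<beta>\<le>2*M - 2*n.
             \<Sum>l\<in>int_seqs \<beta> k. \<Sum>m\<in>int_seqs (2*M - 2*n - \<beta>) p.
        ((- real n - 3/2) gchoose k) * real ((2*n) choose p) * fact k * fact p
          / (4 ^ n * 2 powi (int n - int M) * fact n)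
        * I_int \<Omega> \<alpha> l m
        * B t powr (- real n - 3/2 - real k) * (deriv A t) ^ (2*n - p) * P_prod A B t l m)
    + 1/4 * (\<Sum>k\<le>2*M - 2. \<Sum>p\<le>2*M - 2. \<Sum>n\<le>M - 1. \<Sum>\<beta>\<le>2*M - 2 - 2*n.
             \<Sum>l\<in>int_seqs \<beta> k. \<Sum>m\<in>int_seqs (2*M - 2 - 2*n - \<beta>) p.
        (((- real n - 5/2) gchoose k) * real ((2*n + 2) choose p)
            * B t powr (- 5/2) * (deriv A t) ^ (2*n + 2 - p)
          - ((- real n - 1/2) gchoose k) * real ((2*n) choose p)
            * B t powr (- 1/2) * (deriv A t) ^ (2*n - p))
        * (fact k * fact p / (4 ^ n * 2 powi (int n - int M + 1) * fact n))
        * I_int \<Omega> \<alpha> l m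
        * B t powr (- real n - real k) * P_prod A B t l m)"
    (is "_ = 1/2 * ?S1 + 1/4 * ?S2")
proof -
  interpret brownian_bridge \<Omega> \<alpha> by (rule bridge)
  have B_pos: "B t > 0" using a_pos[of t] by (simp add: A_eq B_eq)
  \<comment> \<open>\<open>E r m N\<close> is the expectation of the coefficient with index
    \<open>2 * N\<close>.\<close>
  define E where "E r m N =
    (\<Sum>k\<le>2*N. \<Sum>p\<le>2*N. \<Sum>n\<le>N. \<Sum>\<beta>\<le>2*N - 2*n. \<Sum>l\<in>int_seqs \<beta> k. \<Sum>l'\<in>int_seqs (2*N - 2*n - \<beta>) p.
      ((r - real n) gchoose k) * real ((2*n + m) choose p) * fact k * fact p * 2 ^ (N - n) / (4 ^ n * fact n)
      * B t powr (r - real n - real k) * (deriv A t) ^ (2*n + m - p) * P_prod A B t l l'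
      * I_int \<Omega> \<alpha> l l')" for r m N
  note C = has_bochner_integral_C_coeff[where B=B and t=t, OF B_pos, of A, folded E_def]
  have M2: "2 * M - 2 = 2 * (M - 1)" by simp
  have "has_bochner_integral \<Omega> (\<lambda>\<omega>. 1/2 * C_coeff A B t (\<lambda>v. \<alpha> v \<omega>) (-3/2) 0 (2*M)
      + 1/4 * (C_coeff A B t (\<lambda>v. \<alpha> v \<omega>) (-5/2) 2 (2*M - 2) - C_coeff A B t (\<lambda>v. \<alpha> v \<omega>) (-1/2) 0 (2*M - 2)))
      (1/2 * E (-3/2) 0 M + 1/4 * (E (-5/2) 2 (M - 1) - E (-1/2) 0 (M - 1)))"
    unfolding M2
    by (intro has_bochner_integral_add has_bochner_integral_mult_right has_bochner_integral_diff C)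
  hence heat: "heat_coeff \<Omega> \<alpha> a M t = 1/2 * E (-3/2) 0 M + 1/4 * (E (-5/2) 2 (M - 1) - E (-1/2) 0 (M - 1))"
    unfolding heat_coeff_def Let_def A_eq[symmetric] B_eq[symmetric]
    by (rule has_bochner_integral_integral_eq)
  \<comment> \<open>The expansion carries the natural power \<open>2 ^ (N - n)\<close>, while the
    theorem divides by an integer power of 2.\<close>
  have pow2: "2 ^ (N - n) = 1 / (2::real) powi (int n - int N)" if "n \<le> N" for n N
  proof -
    have "(2::real) ^ (N - n) = 2 powi (- (int n - int N))" using that by (simp flip: power_int_of_nat add: of_nat_diff)
    thus ?thesis unfolding power_int_minus by (simp add: field_simps)
  qed
  have "E (-3/2) 0 M = ?S1"
  proof -
    have r: "- 3 / 2 - real n = - real n - 3 / 2" for n by simp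
    show ?thesis unfolding E_def r by (intro sum.cong refl, subst pow2) (simp_all add: mult_ac)
  qed
  \<comment> \<open>The two expansions have the same index set, so their difference is taken term by
    term.\<close>
  moreover have "E (-5/2) 2 (M - 1) - E (-1/2) 0 (M - 1) = ?S2"
    unfolding E_def M2 sum_subtractf[symmetric]
  proof (intro sum.cong refl)
    fix k p n \<beta> l m
    assume "n \<in> {..M - 1}"
    \<comment> \<open>With \<open>N = M - 1\<close> the exponent \<open>n - N\<close> becomes
      \<open>n - M + 1\<close>; this uses \<open>M \<ge> 1\<close>.\<close>
    hence pow: "2 ^ (M - 1 - n) = 1 / (2::real) powi (int n - int M + 1)"
      using pow2[of n "M - 1"] M_ge by (simp add: of_nat_diff algebra_simps)
    \<comment> \<open>Splits off the power of \<open>B t\<close> in which the two terms differ,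
      leaving a common factor.\<close>
    have powr: "B t powr (r - real n - real k) = B t powr r * B t powr (- real n - real k)" for r
      unfolding powr_add[symmetric] by (simp add: algebra_simps)
    show "(- 5 / 2 - real n gchoose k) * real (2 * n + 2 choose p) * fact k * fact p * 2 ^ (M - 1 - n) / (4 ^ n * fact n)
        * B t powr (- 5 / 2 - real n - real k) * deriv A t ^ (2 * n + 2 - p) * P_prod A B t l m * I_int \<Omega> \<alpha> l m
      - (- 1 / 2 - real n gchoose k) * real (2 * n + 0 choose p) * fact k * fact p * 2 ^ (M - 1 - n) / (4 ^ n * fact n)
        * B t powr (- 1 / 2 - real n - real k) * deriv A t ^ (2 * n + 0 - p) * P_prod A B t l m * I_int \<Omega> \<alpha> l m
      = (((- real n - 5/2) gchoose k) * real ((2*n + 2) choose p)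
            * B t powr (- 5/2) * (deriv A t) ^ (2*n + 2 - p)
          - ((- real n - 1/2) gchoose k) * real ((2*n) choose p)
            * B t powr (- 1/2) * (deriv A t) ^ (2*n - p))
        * (fact k * fact p / (4 ^ n * 2 powi (int n - int M + 1) * fact n))
        * I_int \<Omega> \<alpha> l m
        * B t powr (- real n - real k) * P_prod A B t l m"
    proof -
      have r: "- 5 / 2 - real n = - real n - 5 / 2" "- 1 / 2 - real n = - real n - 1 / 2" by simp_all
      show ?thesis unfolding pow powr unfolding r by (simp add: field_simps)
    qed
  qed
  ultimately show ?thesis unfolding heat by simp
qed

end
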